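(* Let $\Bbbk$ be a field of characteristic zero. (1) If $(\mathfrak{g},[\cdot,\cdot])$ is an anticommutative $\Bbbk$-algebra, then its triple $(\mathfrak{T}(\mathfrak{g}),\odot)$ is isomorphic to $\mathfrak{so}(3)\otimes_{\Bbbk}\mathfrak{g}$. (2) If $(\mathbb{A},\circ)$ is a commutative $\Bbbk$-algebra, then its triple $(\mathfrak{T}(\mathbb{A}),\odot)$ is isomorphic to $\mathbb{E}^3(\Bbbk)\otimes_{\Bbbk}\mathbb{A}$.
   Context: Algebras are finite-dimensional, not assumed unital or associative. The triple of a $\Bbbk$-algebra $(\mathbb{A},\circ)$ is $\mathfrak{T}(\mathbb{A})=\mathbb{A}\oplus\mathbb{A}\oplus\mathbb{A}$ with the commutative multiplication $$x\odot y=\tfrac12\big(x_2\circ y_3+y_2\circ x_3,\;x_3\circ y_1+y_3\circ x_1,\;x_1\circ y_2+y_1\circ x_2\big),$$ for $x=(x_1,x_2,x_3)$, $y=(y_1,y_2,y_3)$. $\mathfrak{so}(3)$ is the Lie algebra over $\Bbbk$ with basis $e_1,e_2,e_3$ and $[e_1,e_2]=e_3$, $[e_2,e_3]=e_1$, $[e_3,e_1]=e_2$. The tensor product of two commutative, or two anticommutative, algebras carries the commutative product determined by $(a_1\otimes b_1)(a_2\otimes b_2)=(a_1a_2)\otimes(b_1b_2)$. $\mathbb{E}^3(\Bbbk)$ is the $3$-dimensional simplicial algebra: the commutative algebra spanned by $\gamma_0,\gamma_1,\gamma_2,\gamma_3$ with $\sum_{i=0}^{3}\gamma_i=0$ (any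 three forming a basis), $\gamma_i\circ\gamma_i=\gamma_i$, and $\gamma_i\circ\gamma_j=-\tfrac12(\gamma_i+\gamma_j)$ for $i\neq j$. *)

theory Defs
  imports "HOL-Algebra.Module" "HOL-Algebra.QuotRing"
begin

definition char_zero :: "('k, 'm) ring_scheme \<Rightarrow> bool" where
  "char_zero K \<longleftrightarrow> (\<forall>n::nat. n > 0 \<longrightarrow> add_pow K n \<one>\<^bsub>K\<^esub> \<noteq> \<zero>\<^bsub>K\<^esub>)"

section \<open>Nonassociative algebras\<close>

text \<open>
  An algebra is a \<^typ>\<open>('k, 'a) module\<close> whose \<open>mult\<close> field is bilinear. The library locale
  \<^locale>\<open>algebra\<close> is not applicable since it requires a commutative ring with unit.
  The \<open>one\<close> field plays no role; it is \<open>undefined\<close> in all concrete algebras below.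
\<close>

locale nonassoc_algebra = module K A for K :: "('k, 'm) ring_scheme" and A :: "('k, 'a) module" +
  assumes mult_closed:
      "\<lbrakk>x \<in> carrier A; y \<in> carrier A\<rbrakk> \<Longrightarrow> x \<otimes>\<^bsub>A\<^esub> y \<in> carrier A"
    and mult_add_left:
      "\<lbrakk>x \<in> carrier A; y \<in> carrier A; z \<in> carrier A\<rbrakk> \<Longrightarrow>
        (x \<oplus>\<^bsub>A\<^esub> y) \<otimes>\<^bsub>A\<^esub> z = x \<otimes>\<^bsub>A\<^esub> z \<oplus>\<^bsub>A\<^esub> y \<otimes>\<^bsub>A\<^esub> z"
    and mult_add_right:
      "\<lbrakk>x \<in> carrier A; y \<in> carrier A; z \<in> carrier A\<rbrakk> \<Longrightarrow>
        x \<otimes>\<^bsub>A\<^esub> (y \<oplus>\<^bsub>A\<^esub> z) = x \<otimes>\<^bsub>A\<^esub> y \<oplus>\<^bsub>A\<^esub> x \<otimes>\<^bsub>A\<^esub> z"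
    and mult_smult_left:
      "\<lbrakk>c \<in> carrier K; x \<in> carrier A; y \<in> carrier A\<rbrakk> \<Longrightarrow>
        (c \<odot>\<^bsub>A\<^esub> x) \<otimes>\<^bsub>A\<^esub> y = c \<odot>\<^bsub>A\<^esub> (x \<otimes>\<^bsub>A\<^esub> y)"
    and mult_smult_right:
      "\<lbrakk>c \<in> carrier K; x \<in> carrier A; y \<in> carrier A\<rbrakk> \<Longrightarrow>
        x \<otimes>\<^bsub>A\<^esub> (c \<odot>\<^bsub>A\<^esub> y) = c \<odot>\<^bsub>A\<^esub> (x \<otimes>\<^bsub>A\<^esub> y)"

definition finite_dimensional :: "('k, 'm) ring_scheme \<Rightarrow> ('k, 'a) module \<Rightarrow> bool" where
  "finite_dimensional K A \<longleftrightarrow>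
    (\<exists>S. finite S \<and> S \<subseteq> carrier A \<and>
      (\<forall>x \<in> carrier A. \<exists>c \<in> S \<rightarrow> carrier K. x = (\<Oplus>\<^bsub>A\<^esub>s\<in>S. c s \<odot>\<^bsub>A\<^esub> s)))"

definition fd_algebra :: "('k, 'm) ring_scheme \<Rightarrow> ('k, 'a) module \<Rightarrow> bool" where
  "fd_algebra K A \<longleftrightarrow> nonassoc_algebra K A \<and> finite_dimensional K A"

definition commutative_mult :: "('k, 'a) module \<Rightarrow> bool" where
  "commutative_mult A \<longleftrightarrow>
    (\<forall>x \<in> carrier A. \<forall>y \<in> carrier A. x \<otimes>\<^bsub>A\<^esub> y = y \<otimes>\<^bsub>A\<^esub> x)"

definition anticommutative_mult :: "('k, 'a) module \<Rightarrow> bool" where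
  "anticommutative_mult A \<longleftrightarrow>
    (\<forall>x \<in> carrier A. \<forall>y \<in> carrier A. x \<otimes>\<^bsub>A\<^esub> y = \<ominus>\<^bsub>A\<^esub> (y \<otimes>\<^bsub>A\<^esub> x))"

definition algebra_iso ::
  "('k, 'm) ring_scheme \<Rightarrow> ('k, 'a) module \<Rightarrow> ('k, 'b) module \<Rightarrow> ('a \<Rightarrow> 'b) set" where
  "algebra_iso K A B =
    {f. bij_betw f (carrier A) (carrier B) \<and>
      (\<forall>x \<in> carrier A. \<forall>y \<in> carrier A. f (x \<oplus>\<^bsub>A\<^esub> y) = f x \<oplus>\<^bsub>B\<^esub> f y) \<and>
      (\<forall>c \<in> carrier K. \<forall>x \<in> carrier A. f (c \<odot>\<^bsub>A\<^esub> x) = c \<odot>\<^bsub>B\<^esub> f x) \<and>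
      (\<forall>x \<in> carrier A. \<forall>y \<in> carrier A. f (x \<otimes>\<^bsub>A\<^esub> y) = f x \<otimes>\<^bsub>B\<^esub> f y)}"

definition algebras_isomorphic ::
  "('k, 'm) ring_scheme \<Rightarrow> ('k, 'a) module \<Rightarrow> ('k, 'b) module \<Rightarrow> bool" where
  "algebras_isomorphic K A B \<longleftrightarrow> algebra_iso K A B \<noteq> {}"

section \<open>Algebras on a threefold direct sum\<close>

definition cube ::
  "('k, 'a) module \<Rightarrow> ('a \<times> 'a \<times> 'a \<Rightarrow> 'a \<times> 'a \<times> 'a \<Rightarrow> 'a \<times> 'a \<times> 'a)
    \<Rightarrow> ('k, 'a \<times> 'a \<times> 'a) module" where
  "cube M m =
    \<lparr>carrier = carrier M \<times> carrier M \<times> carrier M,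
     mult = m,
     one = undefined,
     zero = (\<zero>\<^bsub>M\<^esub>, \<zero>\<^bsub>M\<^esub>, \<zero>\<^bsub>M\<^esub>),
     add = (\<lambda>(x1, x2, x3) (y1, y2, y3). (x1 \<oplus>\<^bsub>M\<^esub> y1, x2 \<oplus>\<^bsub>M\<^esub> y2, x3 \<oplus>\<^bsub>M\<^esub> y3)),
     smult = (\<lambda>c (x1, x2, x3). (c \<odot>\<^bsub>M\<^esub> x1, c \<odot>\<^bsub>M\<^esub> x2, c \<odot>\<^bsub>M\<^esub> x3))\<rparr>"

definition half :: "('k, 'm) ring_scheme \<Rightarrow> 'k" where
  "half K = inv\<^bsub>K\<^esub> (\<one>\<^bsub>K\<^esub> \<oplus>\<^bsub>K\<^esub> \<one>\<^bsub>K\<^esub>)"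

definition triple :: "('k, 'm) ring_scheme \<Rightarrow> ('k, 'a) module \<Rightarrow> ('k, 'a \<times> 'a \<times> 'a) module" where
  "triple K A = cube A (\<lambda>(x1, x2, x3) (y1, y2, y3).
    (half K \<odot>\<^bsub>A\<^esub> (x2 \<otimes>\<^bsub>A\<^esub> y3 \<oplus>\<^bsub>A\<^esub> y2 \<otimes>\<^bsub>A\<^esub> x3),
     half K \<odot>\<^bsub>A\<^esub> (x3 \<otimes>\<^bsub>A\<^esub> y1 \<oplus>\<^bsub>A\<^esub> y3 \<otimes>\<^bsub>A\<^esub> x1),
     half K \<odot>\<^bsub>A\<^esub> (x1 \<otimes>\<^bsub>A\<^esub> y2 \<oplus>\<^bsub>A\<^esub> y1 \<otimes>\<^bsub>A\<^esub> x2)))"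

definition self_module :: "('k, 'm) ring_scheme \<Rightarrow> ('k, 'k) module" where
  "self_module K =
    \<lparr>carrier = carrier K, mult = mult K, one = undefined, zero = zero K, add = add K,
     smult = mult K\<rparr>"

text \<open>
  The triples (1,0,0), (0,1,0), (0,0,1) are the basis \<open>e1\<close>, \<open>e2\<close>, \<open>e3\<close> of so(3), with the
  bracket extended bilinearly from the basis; see \<open>so3_table\<close> below.
\<close>

definition so3 :: "('k, 'm) ring_scheme \<Rightarrow> ('k, 'k \<times> 'k \<times> 'k) module" where
  "so3 K = cube (self_module K) (\<lambda>(x1, x2, x3) (y1, y2, y3).
    (x2 \<otimes>\<^bsub>K\<^esub> y3 \<ominus>\<^bsub>K\<^esub> x3 \<otimes>\<^bsub>K\<^esub> y2,
     x3 \<otimes>\<^bsub>K\<^esub> y1 \<ominus>\<^bsub>K\<^esub> x1 \<otimes>\<^bsub>K\<^esub> y3,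
     x1 \<otimes>\<^bsub>K\<^esub> y2 \<ominus>\<^bsub>K\<^esub> x2 \<otimes>\<^bsub>K\<^esub> y1))"

text \<open>
  The triple \<open>(x1, x2, x3)\<close> stands for \<open>x1 \<gamma>1 + x2 \<gamma>2 + x3 \<gamma>3\<close>, and \<open>\<gamma>0 = - (\<gamma>1 + \<gamma>2 + \<gamma>3)\<close>.
  The product is the bilinear extension of \<open>\<gamma>i \<gamma>i = \<gamma>i\<close> and \<open>\<gamma>i \<gamma>j = -1/2 (\<gamma>i + \<gamma>j)\<close> for
  distinct \<open>i\<close>, \<open>j\<close> in \<open>{1, 2, 3}\<close>, so that its coordinate at \<open>i\<close> is
  \<open>xi yi - 1/2 (\<Sum>j\<noteq>i. xi yj + xj yi)\<close>. The relations that involve \<open>\<gamma>0\<close> then follow; see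
  \<open>simplicial_table\<close> below.
\<close>

definition simplicial3 :: "('k, 'm) ring_scheme \<Rightarrow> ('k, 'k \<times> 'k \<times> 'k) module" where
  "simplicial3 K = cube (self_module K) (\<lambda>(x1, x2, x3) (y1, y2, y3).
    (x1 \<otimes>\<^bsub>K\<^esub> y1 \<ominus>\<^bsub>K\<^esub> half K \<otimes>\<^bsub>K\<^esub>
       ((x1 \<otimes>\<^bsub>K\<^esub> y2 \<oplus>\<^bsub>K\<^esub> x2 \<otimes>\<^bsub>K\<^esub> y1) \<oplus>\<^bsub>K\<^esub> (x1 \<otimes>\<^bsub>K\<^esub> y3 \<oplus>\<^bsub>K\<^esub> x3 \<otimes>\<^bsub>K\<^esub> y1)),
     x2 \<otimes>\<^bsub>K\<^esub> y2 \<ominus>\<^bsub>K\<^esub> half K \<otimes>\<^bsub>K\<^esub>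
       ((x2 \<otimes>\<^bsub>K\<^esub> y1 \<oplus>\<^bsub>K\<^esub> x1 \<otimes>\<^bsub>K\<^esub> y2) \<oplus>\<^bsub>K\<^esub> (x2 \<otimes>\<^bsub>K\<^esub> y3 \<oplus>\<^bsub>K\<^esub> x3 \<otimes>\<^bsub>K\<^esub> y2)),
     x3 \<otimes>\<^bsub>K\<^esub> y3 \<ominus>\<^bsub>K\<^esub> half K \<otimes>\<^bsub>K\<^esub>
       ((x3 \<otimes>\<^bsub>K\<^esub> y1 \<oplus>\<^bsub>K\<^esub> x1 \<otimes>\<^bsub>K\<^esub> y3) \<oplus>\<^bsub>K\<^esub> (x3 \<otimes>\<^bsub>K\<^esub> y2 \<oplus>\<^bsub>K\<^esub> x2 \<otimes>\<^bsub>K\<^esub> y3))))"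

definition simplicial_gen :: "('k, 'm) ring_scheme \<Rightarrow> nat \<Rightarrow> 'k \<times> 'k \<times> 'k" where
  "simplicial_gen K i =
    (if i = 0 then (\<ominus>\<^bsub>K\<^esub> \<one>\<^bsub>K\<^esub>, \<ominus>\<^bsub>K\<^esub> \<one>\<^bsub>K\<^esub>, \<ominus>\<^bsub>K\<^esub> \<one>\<^bsub>K\<^esub>)
     else if i = 1 then (\<one>\<^bsub>K\<^esub>, \<zero>\<^bsub>K\<^esub>, \<zero>\<^bsub>K\<^esub>)
     else if i = 2 then (\<zero>\<^bsub>K\<^esub>, \<one>\<^bsub>K\<^esub>, \<zero>\<^bsub>K\<^esub>)
     else (\<zero>\<^bsub>K\<^esub>, \<zero>\<^bsub>K\<^esub>, \<one>\<^bsub>K\<^esub>))"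

lemma (in field) half_props:
  assumes "char_zero R"
  shows "half R \<in> carrier R" and "half R \<oplus> half R = \<one>"
proof -
  have "add_pow R (2::nat) \<one> \<noteq> \<zero>"
    using assms unfolding char_zero_def by auto
  moreover have "add_pow R (2::nat) \<one> = \<one> \<oplus> \<one>"
    by (simp add: numeral_2_eq_2)
  ultimately have "\<one> \<oplus> \<one> \<noteq> \<zero>" by simp
  hence u: "\<one> \<oplus> \<one> \<in> Units R" by (simp add: field_Units)
  show h: "half R \<in> carrier R" unfolding half_def using u by simp
  have "(\<one> \<oplus> \<one>) \<otimes> half R = \<one>" unfolding half_def using u by simp
  thus "half R \<oplus> half R = \<one>" using h by (simp add: l_distr)
qed

lemma cube_module:
  fixes M :: "('k, 'a) module"
  assumes "module K M"
  shows "module K (cube M m)"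
proof -
  interpret module K M by fact
  show ?thesis
  proof (rule moduleI)
    show "abelian_group (cube M m)"
    proof (rule abelian_groupI)
      fix x assume "x \<in> carrier (cube M m)"
      then obtain x1 x2 x3 where x: "x = (x1, x2, x3)"
          "x1 \<in> carrier M" "x2 \<in> carrier M" "x3 \<in> carrier M"
        by (auto simp: cube_def)
      show "\<exists>y\<in>carrier (cube M m). y \<oplus>\<^bsub>cube M m\<^esub> x = \<zero>\<^bsub>cube M m\<^esub>"
        by (rule bexI[of _ "(\<ominus>\<^bsub>M\<^esub> x1, \<ominus>\<^bsub>M\<^esub> x2, \<ominus>\<^bsub>M\<^esub> x3)"])
          (use x in \<open>auto simp: cube_def M.l_neg\<close>)
    qed (auto simp: cube_def M.a_ac)
  qed (auto simp: cube_def smult_l_distr smult_r_distr smult_assoc1 R.is_cring)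
qed

lemma (in cring) self_module: "module R (self_module R)"
proof (rule moduleI)
  show "abelian_group (self_module R)"
    by (rule abelian_groupI) (auto simp: self_module_def a_ac intro: bexI[of _ "\<ominus> _"] l_neg)
qed (auto simp: self_module_def l_distr r_distr m_assoc is_cring)

lemma (in field) so3_algebra: "nonassoc_algebra R (so3 R)"
proof -
  interpret S: module R "so3 R"
    unfolding so3_def by (rule cube_module[OF self_module])
  show ?thesis
    by unfold_locales (auto simp: so3_def cube_def self_module_def; algebra)+
qed

lemma (in field) so3_table:
  "(\<one>, \<zero>, \<zero>) \<otimes>\<^bsub>so3 R\<^esub> (\<zero>, \<one>, \<zero>) = (\<zero>, \<zero>, \<one>)"
  "(\<zero>, \<one>, \<zero>) \<otimes>\<^bsub>so3 R\<^esub> (\<zero>, \<zero>, \<one>) = (\<one>, \<zero>, \<zero>)"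
  "(\<zero>, \<zero>, \<one>) \<otimes>\<^bsub>so3 R\<^esub> (\<one>, \<zero>, \<zero>) = (\<zero>, \<one>, \<zero>)"
  by (auto simp: so3_def cube_def self_module_def minus_eq)

lemma (in field) so3_alternating: "x \<in> carrier (so3 R) \<Longrightarrow> x \<otimes>\<^bsub>so3 R\<^esub> x = \<zero>\<^bsub>so3 R\<^esub>"
  by (auto simp: so3_def cube_def self_module_def; algebra)

lemma (in field) simplicial_algebra:
  assumes "char_zero R"
  shows "nonassoc_algebra R (simplicial3 R)"
proof -
  note [simp, intro] = half_props(1)[OF assms]
  interpret S: module R "simplicial3 R"
    unfolding simplicial3_def by (rule cube_module[OF self_module])
  show ?thesis
    by unfold_locales (auto simp: simplicial3_def cube_def self_module_def l_distr r_distr minus_eq minus_add m_ac a_ac r_minus l_minus)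
qed

lemma (in field) simplicial_table:
  assumes "char_zero R"
  defines "E \<equiv> simplicial3 R" and "g \<equiv> simplicial_gen R"
  shows "\<And>x y. \<lbrakk>x \<in> carrier E; y \<in> carrier E\<rbrakk> \<Longrightarrow> x \<otimes>\<^bsub>E\<^esub> y = y \<otimes>\<^bsub>E\<^esub> x"
    and "g 0 \<oplus>\<^bsub>E\<^esub> (g 1 \<oplus>\<^bsub>E\<^esub> (g 2 \<oplus>\<^bsub>E\<^esub> g 3)) = \<zero>\<^bsub>E\<^esub>"
    and "\<And>i. i \<in> {0..3} \<Longrightarrow> g i \<otimes>\<^bsub>E\<^esub> g i = g i"
    and "\<And>i j. \<lbrakk>i \<in> {0..3}; j \<in> {0..3}; i \<noteq> j\<rbrakk> \<Longrightarrow>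
      g i \<otimes>\<^bsub>E\<^esub> g j = (\<ominus> half R) \<odot>\<^bsub>E\<^esub> (g i \<oplus>\<^bsub>E\<^esub> g j)"
proof -
  note h = half_props[OF assms(1)]
  note [simp, intro] = h(1)
  note defs = E_def g_def simplicial3_def cube_def self_module_def simplicial_gen_def
  have ivl: "{0..3} = {0, 1, 2, 3::nat}" by auto
  have h2: "half R \<oplus> (half R \<oplus> x) = \<one> \<oplus> x" if "x \<in> carrier R" for x
    using that h by (simp flip: a_assoc)
  show "x \<otimes>\<^bsub>E\<^esub> y = y \<otimes>\<^bsub>E\<^esub> x" if "x \<in> carrier E" "y \<in> carrier E" for x y
    using that by (auto simp: defs l_distr r_distr minus_eq minus_add m_ac a_ac r_minus l_minus)
  show "g 0 \<oplus>\<^bsub>E\<^esub> (g 1 \<oplus>\<^bsub>E\<^esub> (g 2 \<oplus>\<^bsub>E\<^esub> g 3)) = \<zero>\<^bsub>E\<^esub>"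
    by (auto simp: defs l_neg)
  show "g i \<otimes>\<^bsub>E\<^esub> g i = g i" if "i \<in> {0..3}" for i
    using that h unfolding ivl
    by (auto simp: defs minus_eq l_minus r_minus minus_add r_distr a_assoc h2 r_neg l_neg r_neg1 r_neg2)
  show "g i \<otimes>\<^bsub>E\<^esub> g j = (\<ominus> half R) \<odot>\<^bsub>E\<^esub> (g i \<oplus>\<^bsub>E\<^esub> g j)"
    if "i \<in> {0..3}" "j \<in> {0..3}" "i \<noteq> j" for i j
    using that h unfolding ivl
    by (auto simp: defs minus_eq l_minus r_minus minus_add r_distr a_assoc h2 r_neg l_neg r_neg1 r_neg2)
qed

section \<open>Tensor products\<close>

definition free_module :: "('k, 'm) ring_scheme \<Rightarrow> 's set \<Rightarrow> ('k, 's \<Rightarrow> 'k) module" where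
  "free_module K S =
    \<lparr>carrier = {p. finite {s. p s \<noteq> \<zero>\<^bsub>K\<^esub>} \<and> (\<forall>s\<in>S. p s \<in> carrier K) \<and> (\<forall>s. s \<notin> S \<longrightarrow> p s = \<zero>\<^bsub>K\<^esub>)},
     mult = undefined,
     one = undefined,
     zero = (\<lambda>_. \<zero>\<^bsub>K\<^esub>),
     add = (\<lambda>p q s. p s \<oplus>\<^bsub>K\<^esub> q s),
     smult = (\<lambda>c p s. c \<otimes>\<^bsub>K\<^esub> p s)\<rparr>"

definition free_gen :: "('k, 'm) ring_scheme \<Rightarrow> 's \<Rightarrow> 's \<Rightarrow> 'k" where
  "free_gen K s = (\<lambda>t. if t = s then \<one>\<^bsub>K\<^esub> else \<zero>\<^bsub>K\<^esub>)"

text \<open>The linear map from a free module to \<open>M\<close> with \<open>free_gen K s \<mapsto> f s\<close>.\<close>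

definition lin_ext ::
  "('k, 'm) ring_scheme \<Rightarrow> ('k, 'a, 'n) module_scheme \<Rightarrow> ('s \<Rightarrow> 'a) \<Rightarrow> ('s \<Rightarrow> 'k) \<Rightarrow> 'a" where
  "lin_ext K M f p = (\<Oplus>\<^bsub>M\<^esub>s\<in>{s. p s \<noteq> \<zero>\<^bsub>K\<^esub>}. p s \<odot>\<^bsub>M\<^esub> f s)"

text \<open>The product on the free module is the bilinear extension of an operation \<open>m\<close> on \<open>S\<close>.\<close>

definition free_algebra ::
  "('k, 'm) ring_scheme \<Rightarrow> 's set \<Rightarrow> ('s \<Rightarrow> 's \<Rightarrow> 's) \<Rightarrow> ('k, 's \<Rightarrow> 'k) module" where
  "free_algebra K S m = (free_module K S)
    \<lparr>mult := (\<lambda>p q. lin_ext K (free_module K S)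
      (\<lambda>s. lin_ext K (free_module K S) (\<lambda>t. free_gen K (m s t)) q) p)\<rparr>"

definition submodule_span ::
  "('k, 'm) ring_scheme \<Rightarrow> ('k, 'a) module \<Rightarrow> 'a set \<Rightarrow> 'a set" where
  "submodule_span K M G = \<Inter>{H. submodule H K M \<and> G \<subseteq> H}"

definition tensor_free ::
  "('k, 'm) ring_scheme \<Rightarrow> ('k, 'a) module \<Rightarrow> ('k, 'b) module \<Rightarrow> ('k, 'a \<times> 'b \<Rightarrow> 'k) module" where
  "tensor_free K A B = free_algebra K (carrier A \<times> carrier B)
    (\<lambda>(a1, b1) (a2, b2). (a1 \<otimes>\<^bsub>A\<^esub> a2, b1 \<otimes>\<^bsub>B\<^esub> b2))"

definition tensor_gens ::
  "('k, 'm) ring_scheme \<Rightarrow> ('k, 'a) module \<Rightarrow> ('k, 'b) module \<Rightarrow> ('a \<times> 'b \<Rightarrow> 'k) set" where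
  "tensor_gens K A B = (let F = tensor_free K A B; g = free_gen K in
     {g (a \<oplus>\<^bsub>A\<^esub> a', b) \<ominus>\<^bsub>F\<^esub> (g (a, b) \<oplus>\<^bsub>F\<^esub> g (a', b)) | a a' b.
        a \<in> carrier A \<and> a' \<in> carrier A \<and> b \<in> carrier B} \<union>
     {g (a, b \<oplus>\<^bsub>B\<^esub> b') \<ominus>\<^bsub>F\<^esub> (g (a, b) \<oplus>\<^bsub>F\<^esub> g (a, b')) | a b b'.
        a \<in> carrier A \<and> b \<in> carrier B \<and> b' \<in> carrier B} \<union>
     {g (c \<odot>\<^bsub>A\<^esub> a, b) \<ominus>\<^bsub>F\<^esub> c \<odot>\<^bsub>F\<^esub> g (a, b) | c a b.
        c \<in> carrier K \<and> a \<in> carrier A \<and> b \<in> carrier B} \<union>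
     {g (a, c \<odot>\<^bsub>B\<^esub> b) \<ominus>\<^bsub>F\<^esub> c \<odot>\<^bsub>F\<^esub> g (a, b) | c a b.
        c \<in> carrier K \<and> a \<in> carrier A \<and> b \<in> carrier B})"

definition tensor_rel ::
  "('k, 'm) ring_scheme \<Rightarrow> ('k, 'a) module \<Rightarrow> ('k, 'b) module \<Rightarrow> ('a \<times> 'b \<Rightarrow> 'k) set" where
  "tensor_rel K A B = submodule_span K (tensor_free K A B) (tensor_gens K A B)"

text \<open>For a two-sided ideal \<open>I\<close>, as in \<^const>\<open>FactRing\<close>; see \<open>quotient_algebra_coset\<close> below.\<close>

definition quotient_algebra :: "('k, 'a) module \<Rightarrow> 'a set \<Rightarrow> ('k, 'a set) module" where
  "quotient_algebra A I =
    \<lparr>carrier = a_rcosets\<^bsub>A\<^esub> I,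
     mult = rcoset_mult A I,
     one = undefined,
     zero = I,
     add = set_add A,
     smult = (\<lambda>c X. \<Union>x\<in>X. I +>\<^bsub>A\<^esub> (c \<odot>\<^bsub>A\<^esub> x))\<rparr>"

text \<open>
  The submodule \<^const>\<open>tensor_rel\<close> of bilinearity relations is a two-sided ideal of
  \<^const>\<open>tensor_free\<close>, so the product descends to cosets; see \<open>tensor_algebra\<close> and
  \<open>pure_tensor_mult\<close> below.
\<close>

definition tensor ::
  "('k, 'm) ring_scheme \<Rightarrow> ('k, 'a) module \<Rightarrow> ('k, 'b) module \<Rightarrow> ('k, ('a \<times> 'b \<Rightarrow> 'k) set) module"
  where "tensor K A B = quotient_algebra (tensor_free K A B) (tensor_rel K A B)"

definition pure_tensor ::
  "('k, 'm) ring_scheme \<Rightarrow> ('k, 'a) module \<Rightarrow> ('k, 'b) module \<Rightarrow> 'a \<Rightarrow> 'b \<Rightarrow> ('a \<times> 'b \<Rightarrow> 'k) set" where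
  "pure_tensor K A B a b = tensor_rel K A B +>\<^bsub>tensor_free K A B\<^esub> free_gen K (a, b)"

lemma (in cring) free_module: "module R (free_module R (S :: 'c set))"
proof (rule moduleI)
  have fin: "finite {s. p s \<oplus> q s \<noteq> \<zero>}" if "finite {s. p s \<noteq> \<zero>}" "finite {s. q s \<noteq> \<zero>}" for p q
    by (rule finite_subset[OF _ finite_UnI[OF that]]) auto
  have cl: "p s \<in> carrier R" if "\<forall>s\<in>S. p s \<in> carrier R" "\<forall>s. s \<notin> S \<longrightarrow> p s = \<zero>" for p s
    using that by (cases "s \<in> S") auto
  show "abelian_group (free_module R S)"
  proof (rule abelian_groupI)
    fix p assume p: "p \<in> carrier (free_module R S)"
    have "{s. \<ominus> p s \<noteq> \<zero>} \<subseteq> {s. p s \<noteq> \<zero>}" by auto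
    with p show "\<exists>q\<in>carrier (free_module R S). q \<oplus>\<^bsub>free_module R S\<^esub> p = \<zero>\<^bsub>free_module R S\<^esub>"
      by (intro bexI[of _ "\<lambda>s. \<ominus> p s"])
        (auto simp: free_module_def cl l_neg intro: finite_subset)
  qed (auto simp: free_module_def fin cl a_ac)
  fix a p assume "a \<in> carrier R" and p: "p \<in> carrier (free_module R S)"
  moreover have "{s. a \<otimes> p s \<noteq> \<zero>} \<subseteq> {s. p s \<noteq> \<zero>}" using calculation by auto
  ultimately show "a \<odot>\<^bsub>free_module R S\<^esub> p \<in> carrier (free_module R S)"
    by (auto simp: free_module_def intro: finite_subset)
next
  fix p :: "'c \<Rightarrow> 'a" assume "p \<in> carrier (free_module R S)"
  hence "p s \<in> carrier R" for s by (cases "s \<in> S") (auto simp: free_module_def)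
  thus "\<one> \<odot>\<^bsub>free_module R S\<^esub> p = p" by (simp add: free_module_def)
next
  fix a b and p :: "'c \<Rightarrow> 'a"
  assume ab: "a \<in> carrier R" "b \<in> carrier R" and "p \<in> carrier (free_module R S)"
  hence "p s \<in> carrier R" for s by (cases "s \<in> S") (auto simp: free_module_def)
  with ab show "(a \<oplus> b) \<odot>\<^bsub>free_module R S\<^esub> p =
        a \<odot>\<^bsub>free_module R S\<^esub> p \<oplus>\<^bsub>free_module R S\<^esub> b \<odot>\<^bsub>free_module R S\<^esub> p"
      "(a \<otimes> b) \<odot>\<^bsub>free_module R S\<^esub> p = a \<odot>\<^bsub>free_module R S\<^esub> (b \<odot>\<^bsub>free_module R S\<^esub> p)"
    by (simp_all add: free_module_def l_distr m_assoc)
next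
  fix a and p q :: "'c \<Rightarrow> 'a"
  assume a: "a \<in> carrier R" and "p \<in> carrier (free_module R S)" "q \<in> carrier (free_module R S)"
  hence "p s \<in> carrier R" "q s \<in> carrier R" for s by (cases "s \<in> S"; auto simp: free_module_def)+
  with a show "a \<odot>\<^bsub>free_module R S\<^esub> (p \<oplus>\<^bsub>free_module R S\<^esub> q) =
      a \<odot>\<^bsub>free_module R S\<^esub> p \<oplus>\<^bsub>free_module R S\<^esub> a \<odot>\<^bsub>free_module R S\<^esub> q"
    by (simp add: free_module_def r_distr)
qed (rule is_cring)

lemma (in cring) free_module_closed:
  "p \<in> carrier (free_module R S) \<Longrightarrow> p s \<in> carrier R"
  by (cases "s \<in> S") (auto simp: free_module_def)

lemma (in cring) free_gen_closed:
  "s \<in> S \<Longrightarrow> free_gen R s \<in> carrier (free_module R S)"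
  by (auto simp: free_module_def free_gen_def)

context module
begin

lemma lin_ext_eq:
  assumes "p \<in> carrier (free_module R S)" "f \<in> S \<rightarrow> carrier M"
    and "finite T" "{s. p s \<noteq> \<zero>} \<subseteq> T" "T \<subseteq> S"
  shows "lin_ext R M f p = (\<Oplus>\<^bsub>M\<^esub>s\<in>T. p s \<odot>\<^bsub>M\<^esub> f s)"
  unfolding lin_ext_def
proof (rule M.add.finprod_mono_neutral_cong_left)
  show "finite T" by fact
  show "{s. p s \<noteq> \<zero>} \<subseteq> T" by fact
  show "p i \<odot>\<^bsub>M\<^esub> f i = \<zero>\<^bsub>M\<^esub>" if "i \<in> T - {s. p s \<noteq> \<zero>}" for i
    using that assms by (auto simp: Pi_iff subset_iff)
  show "(\<lambda>s. p s \<odot>\<^bsub>M\<^esub> f s) \<in> T \<rightarrow> carrier M"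
    using assms R.free_module_closed[OF assms(1)] by (auto simp: Pi_iff subset_iff)
qed simp

lemma free_module_support:
  assumes "p \<in> carrier (free_module R S)"
  shows "finite {s. p s \<noteq> \<zero>}" "{s. p s \<noteq> \<zero>} \<subseteq> S"
  using assms by (auto simp: free_module_def)

lemma lin_ext_in_submodule:
  assumes "p \<in> carrier (free_module R S)" "submodule H R M" "\<And>s. s \<in> S \<Longrightarrow> f s \<in> H"
  shows "lin_ext R M f p \<in> H"
proof -
  interpret H: submodule H R M by fact
  note E = submoduleE[OF assms(2)]
  have z: "\<zero>\<^bsub>M\<^esub> \<in> H" using H.one_closed by simp
  have "finite T \<Longrightarrow> T \<subseteq> S \<Longrightarrow> (\<Oplus>\<^bsub>M\<^esub>s\<in>T. p s \<odot>\<^bsub>M\<^esub> f s) \<in> H" for T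
  proof (induction T rule: finite_induct)
    case (insert s T)
    have "p t \<odot>\<^bsub>M\<^esub> f t \<in> H" if "t \<in> S" for t
      using that assms(3) E(4) R.free_module_closed[OF assms(1)] by blast
    moreover from this have "p t \<odot>\<^bsub>M\<^esub> f t \<in> carrier M" if "t \<in> S" for t
      using that E(1) by blast
    ultimately show ?case using insert E(5) by (subst M.finsum_insert) auto
  qed (simp add: z)
  thus ?thesis unfolding lin_ext_def using free_module_support[OF assms(1)] by blast
qed

lemma lin_ext_closed:
  assumes "p \<in> carrier (free_module R S)" "f \<in> S \<rightarrow> carrier M"
  shows "lin_ext R M f p \<in> carrier M"
  using lin_ext_in_submodule[OF assms(1) carrier_is_submodule] assms(2) by blast

lemma lin_ext_add:
  assumes p: "p \<in> carrier (free_module R S)" and q: "q \<in> carrier (free_module R S)"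
    and f: "f \<in> S \<rightarrow> carrier M"
  shows "lin_ext R M f (p \<oplus>\<^bsub>free_module R S\<^esub> q) = lin_ext R M f p \<oplus>\<^bsub>M\<^esub> lin_ext R M f q"
proof -
  interpret F: module R "free_module R S" by (rule R.free_module)
  define T where "T = {s. p s \<noteq> \<zero>} \<union> {s. q s \<noteq> \<zero>}"
  have T: "finite T" "T \<subseteq> S"
    using free_module_support[OF p] free_module_support[OF q] by (auto simp: T_def)
  note cl = R.free_module_closed[OF p] R.free_module_closed[OF q]
  have ap: "(p \<oplus>\<^bsub>free_module R S\<^esub> q) s = p s \<oplus> q s" for s by (simp add: free_module_def)
  have "lin_ext R M f (p \<oplus>\<^bsub>free_module R S\<^esub> q)
      = (\<Oplus>\<^bsub>M\<^esub>s\<in>T. (p \<oplus>\<^bsub>free_module R S\<^esub> q) s \<odot>\<^bsub>M\<^esub> f s)"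
    by (rule lin_ext_eq[where S = S]) (use p q f T in \<open>auto simp: ap T_def\<close>)
  also have "\<dots> = (\<Oplus>\<^bsub>M\<^esub>s\<in>T. p s \<odot>\<^bsub>M\<^esub> f s \<oplus>\<^bsub>M\<^esub> q s \<odot>\<^bsub>M\<^esub> f s)"
    by (rule M.finsum_cong') (use f T cl in \<open>auto simp: ap Pi_iff subset_iff intro!: smult_l_distr\<close>)
  also have "\<dots> = (\<Oplus>\<^bsub>M\<^esub>s\<in>T. p s \<odot>\<^bsub>M\<^esub> f s) \<oplus>\<^bsub>M\<^esub> (\<Oplus>\<^bsub>M\<^esub>s\<in>T. q s \<odot>\<^bsub>M\<^esub> f s)"
    by (rule M.finsum_addf) (use f T cl in \<open>auto simp: Pi_iff subset_iff\<close>)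
  also have "\<dots> = lin_ext R M f p \<oplus>\<^bsub>M\<^esub> lin_ext R M f q"
    using lin_ext_eq[OF p f T(1) _ T(2)] lin_ext_eq[OF q f T(1) _ T(2)] by (simp add: T_def)
  finally show ?thesis .
qed

lemma lin_ext_smult:
  assumes p: "p \<in> carrier (free_module R S)" and c: "c \<in> carrier R"
    and f: "f \<in> S \<rightarrow> carrier M"
  shows "lin_ext R M f (c \<odot>\<^bsub>free_module R S\<^esub> p) = c \<odot>\<^bsub>M\<^esub> lin_ext R M f p"
proof -
  interpret F: module R "free_module R S" by (rule R.free_module)
  define T where "T = {s. p s \<noteq> \<zero>}"
  have T: "finite T" "T \<subseteq> S"
    using free_module_support[OF p] by (auto simp: T_def)
  note cl = R.free_module_closed[OF p]
  have ap: "(c \<odot>\<^bsub>free_module R S\<^esub> p) s = c \<otimes> p s" for s by (simp add: free_module_def)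
  have "lin_ext R M f (c \<odot>\<^bsub>free_module R S\<^esub> p)
      = (\<Oplus>\<^bsub>M\<^esub>s\<in>T. (c \<odot>\<^bsub>free_module R S\<^esub> p) s \<odot>\<^bsub>M\<^esub> f s)"
    by (rule lin_ext_eq[where S = S]) (use p c f T in \<open>auto simp: ap T_def\<close>)
  also have "\<dots> = (\<Oplus>\<^bsub>M\<^esub>s\<in>T. c \<odot>\<^bsub>M\<^esub> (p s \<odot>\<^bsub>M\<^esub> f s))"
    by (rule M.finsum_cong') (use f T cl c in \<open>auto simp: ap Pi_iff subset_iff intro!: smult_assoc1\<close>)
  also have "\<dots> = c \<odot>\<^bsub>M\<^esub> lin_ext R M f p"
    unfolding lin_ext_def T_def[symmetric]
    by (rule finsum_smult_ldistr[symmetric]) (use f T cl c in auto)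
  finally show ?thesis .
qed

lemma lin_ext_gen:
  assumes s: "s \<in> S" and f: "f \<in> S \<rightarrow> carrier M"
  shows "lin_ext R M f (free_gen R s) = f s"
proof -
  have "lin_ext R M f (free_gen R s) = (\<Oplus>\<^bsub>M\<^esub>t\<in>{s}. free_gen R s t \<odot>\<^bsub>M\<^esub> f t)"
    by (rule lin_ext_eq[where S = S])
      (use assms R.free_gen_closed[of s S] in \<open>auto simp: free_gen_def\<close>)
  also have "\<dots> = f s" using assms by (auto simp: free_gen_def Pi_iff)
  finally show ?thesis .
qed

lemma lin_ext_fun_add:
  assumes p: "p \<in> carrier (free_module R S)"
    and f: "f \<in> S \<rightarrow> carrier M" and g: "g \<in> S \<rightarrow> carrier M"
  shows "lin_ext R M (\<lambda>s. f s \<oplus>\<^bsub>M\<^esub> g s) p = lin_ext R M f p \<oplus>\<^bsub>M\<^esub> lin_ext R M g p"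
proof -
  note T = free_module_support[OF p] and cl = R.free_module_closed[OF p]
  have "lin_ext R M (\<lambda>s. f s \<oplus>\<^bsub>M\<^esub> g s) p =
      (\<Oplus>\<^bsub>M\<^esub>s\<in>{s. p s \<noteq> \<zero>}. p s \<odot>\<^bsub>M\<^esub> f s \<oplus>\<^bsub>M\<^esub> p s \<odot>\<^bsub>M\<^esub> g s)"
    unfolding lin_ext_def
    by (rule M.finsum_cong') (use T f g cl in \<open>auto simp: Pi_iff subset_iff intro!: smult_r_distr\<close>)
  also have "\<dots> = lin_ext R M f p \<oplus>\<^bsub>M\<^esub> lin_ext R M g p"
    unfolding lin_ext_def by (rule M.finsum_addf) (use T f g cl in \<open>auto simp: Pi_iff subset_iff\<close>)
  finally show ?thesis .
qed

lemma lin_ext_fun_smult: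
  assumes p: "p \<in> carrier (free_module R S)" and c: "c \<in> carrier R"
    and f: "f \<in> S \<rightarrow> carrier M"
  shows "lin_ext R M (\<lambda>s. c \<odot>\<^bsub>M\<^esub> f s) p = c \<odot>\<^bsub>M\<^esub> lin_ext R M f p"
proof -
  note T = free_module_support[OF p] and cl = R.free_module_closed[OF p]
  have "lin_ext R M (\<lambda>s. c \<odot>\<^bsub>M\<^esub> f s) p =
      (\<Oplus>\<^bsub>M\<^esub>s\<in>{s. p s \<noteq> \<zero>}. c \<odot>\<^bsub>M\<^esub> (p s \<odot>\<^bsub>M\<^esub> f s))"
    unfolding lin_ext_def
  proof (rule M.finsum_cong')
    fix s assume "s \<in> {s. p s \<noteq> \<zero>}"
    hence fs: "f s \<in> carrier M" using T f by auto
    have "p s \<odot>\<^bsub>M\<^esub> (c \<odot>\<^bsub>M\<^esub> f s) = (c \<otimes> p s) \<odot>\<^bsub>M\<^esub> f s"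
      using fs cl c by (simp add: smult_assoc1 R.m_comm flip: smult_assoc1)
    thus "p s \<odot>\<^bsub>M\<^esub> (c \<odot>\<^bsub>M\<^esub> f s) = c \<odot>\<^bsub>M\<^esub> (p s \<odot>\<^bsub>M\<^esub> f s)"
      using fs cl c by (simp add: smult_assoc1)
  qed (use T f cl c in \<open>auto simp: Pi_iff subset_iff\<close>)
  also have "\<dots> = c \<odot>\<^bsub>M\<^esub> lin_ext R M f p"
    unfolding lin_ext_def by (rule finsum_smult_ldistr[symmetric]) (use f T cl c in auto)
  finally show ?thesis .
qed

end

lemma (in cring) free_module_expand:
  assumes p: "p \<in> carrier (free_module R S)"
  shows "p = lin_ext R (free_module R S) (free_gen R) p"
proof -
  interpret F: module R "free_module R S" by (rule free_module)
  note T = F.free_module_support[OF p] and cl = free_module_closed[OF p]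
  have "finite T \<Longrightarrow> T \<subseteq> S \<Longrightarrow>
      (\<Oplus>\<^bsub>free_module R S\<^esub>s\<in>T. p s \<odot>\<^bsub>free_module R S\<^esub> free_gen R s) =
      (\<lambda>s. if s \<in> T then p s else \<zero>)" for T
  proof (induction T rule: finite_induct)
    case empty
    show ?case unfolding F.M.finsum_empty by (simp add: free_module_def)
  next
    case (insert s T)
    have "p t \<odot>\<^bsub>free_module R S\<^esub> free_gen R t \<in> carrier (free_module R S)" if "t \<in> S" for t
      using that cl free_gen_closed[of t S] by auto
    thus ?case
      using insert cl
      by (subst F.M.finsum_insert) (auto simp: free_module_def free_gen_def fun_eq_iff)
  qed
  from this[OF T] show ?thesis
    unfolding lin_ext_def by (auto simp: fun_eq_iff)
qed

lemma (in cring) free_module_submodule_eq: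
  assumes "submodule H R (free_module R S)" "\<And>s. s \<in> S \<Longrightarrow> free_gen R s \<in> H"
  shows "H = carrier (free_module R S)"
proof -
  interpret F: module R "free_module R S" by (rule free_module)
  have "p \<in> H" if p: "p \<in> carrier (free_module R S)" for p
  proof -
    have "lin_ext R (free_module R S) (free_gen R) p \<in> H"
      by (rule F.lin_ext_in_submodule[OF p assms(1)]) (rule assms(2))
    thus ?thesis using free_module_expand[OF p] by metis
  qed
  thus ?thesis using F.submoduleE(1)[OF assms(1)] by (intro equalityI subsetI) auto
qed

lemma module_mult_update:
  fixes M :: "('k, 'a) module"
  assumes "module K M"
  shows "module K (M\<lparr>mult := m\<rparr>)"
proof -
  interpret module K M by fact
  show ?thesis
  proof (rule moduleI)
    show "abelian_group (M\<lparr>mult := m\<rparr>)"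
    proof (rule abelian_groupI)
      fix x assume "x \<in> carrier (M\<lparr>mult := m\<rparr>)"
      thus "\<exists>y\<in>carrier (M\<lparr>mult := m\<rparr>). y \<oplus>\<^bsub>M\<lparr>mult := m\<rparr>\<^esub> x = \<zero>\<^bsub>M\<lparr>mult := m\<rparr>\<^esub>"
        using M.l_neg[of x] M.a_inv_closed[of x] by auto
    qed (auto simp: M.a_ac)
  qed (auto simp: smult_l_distr smult_r_distr smult_assoc1 R.is_cring)
qed

lemma submodule_mult_update:
  fixes M :: "('k, 'a) module"
  shows "submodule H K (M\<lparr>mult := m\<rparr>) \<longleftrightarrow> submodule H K M"
  by (simp add: submodule_def submodule_axioms_def)

lemma (in cring) free_algebra:
  assumes m: "\<And>s t. \<lbrakk>s \<in> S; t \<in> S\<rbrakk> \<Longrightarrow> m s t \<in> S"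
  shows "nonassoc_algebra R (free_algebra R S m)"
    and "\<lbrakk>s \<in> S; t \<in> S\<rbrakk> \<Longrightarrow> free_gen R s \<otimes>\<^bsub>free_algebra R S m\<^esub> free_gen R t = free_gen R (m s t)"
proof -
  let ?F = "free_module R S" and ?A = "free_algebra R S m"
  interpret F: module R ?F by (rule free_module)
  interpret A: module R ?A
    unfolding free_algebra_def by (rule module_mult_update[OF F.module_axioms])
  let ?L = "\<lambda>q s. lin_ext R ?F (\<lambda>t. free_gen R (m s t)) q"
  have eqs: "carrier ?A = carrier ?F" "add ?A = add ?F" "smult ?A = smult ?F" "zero ?A = zero ?F"
      "\<And>p q. p \<otimes>\<^bsub>?A\<^esub> q = lin_ext R ?F (?L q) p"
    by (simp_all add: free_algebra_def)
  have g: "(\<lambda>t. free_gen R (m s t)) \<in> S \<rightarrow> carrier ?F" if "s \<in> S" for s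
    by (intro Pi_I free_gen_closed m that)
  have L: "?L q \<in> S \<rightarrow> carrier ?F" if "q \<in> carrier ?F" for q
    by (rule Pi_I) (rule F.lin_ext_closed[OF that g])
  have cong: "lin_ext R ?F f p = lin_ext R ?F f' p"
    if p: "p \<in> carrier ?F" and f': "f' \<in> S \<rightarrow> carrier ?F" and eq: "\<And>s. s \<in> S \<Longrightarrow> f s = f' s" for f f' p
    unfolding lin_ext_def
  proof (rule F.M.finsum_cong')
    show "(\<lambda>s. p s \<odot>\<^bsub>?F\<^esub> f' s) \<in> {s. p s \<noteq> \<zero>} \<rightarrow> carrier ?F"
      using F.free_module_support[OF p] free_module_closed[OF p] f' by (auto simp: Pi_iff subset_iff)
    show "p s \<odot>\<^bsub>?F\<^esub> f s = p s \<odot>\<^bsub>?F\<^esub> f' s" if "s \<in> {s. p s \<noteq> \<zero>}" for s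
    proof -
      have "s \<in> S" using that F.free_module_support(2)[OF p] by (rule subsetD[rotated])
      thus ?thesis by (simp only: eq)
    qed
  qed (rule refl)
  show "nonassoc_algebra R ?A"
  proof (unfold_locales, unfold eqs)
    fix x y z assume xyz: "x \<in> carrier ?F" "y \<in> carrier ?F" "z \<in> carrier ?F"
    show "lin_ext R ?F (?L z) (x \<oplus>\<^bsub>?F\<^esub> y) = lin_ext R ?F (?L z) x \<oplus>\<^bsub>?F\<^esub> lin_ext R ?F (?L z) y"
      using xyz L by (intro F.lin_ext_add) auto
    have "lin_ext R ?F (?L (y \<oplus>\<^bsub>?F\<^esub> z)) x = lin_ext R ?F (\<lambda>s. ?L y s \<oplus>\<^bsub>?F\<^esub> ?L z s) x"
      by (rule cong) (use xyz L[of y] L[of z] F.lin_ext_add[OF xyz(2,3) g] in \<open>auto simp: Pi_iff\<close>)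
    also have "\<dots> = lin_ext R ?F (?L y) x \<oplus>\<^bsub>?F\<^esub> lin_ext R ?F (?L z) x"
      using xyz L by (intro F.lin_ext_fun_add) auto
    finally show "lin_ext R ?F (?L (y \<oplus>\<^bsub>?F\<^esub> z)) x =
        lin_ext R ?F (?L y) x \<oplus>\<^bsub>?F\<^esub> lin_ext R ?F (?L z) x" .
  next
    fix c x y assume c: "c \<in> carrier R" and xy: "x \<in> carrier ?F" "y \<in> carrier ?F"
    show "lin_ext R ?F (?L y) (c \<odot>\<^bsub>?F\<^esub> x) = c \<odot>\<^bsub>?F\<^esub> lin_ext R ?F (?L y) x"
      using c xy L by (intro F.lin_ext_smult) auto
    have "lin_ext R ?F (?L (c \<odot>\<^bsub>?F\<^esub> y)) x = lin_ext R ?F (\<lambda>s. c \<odot>\<^bsub>?F\<^esub> ?L y s) x"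
      by (rule cong) (use c xy L[of y] F.lin_ext_smult[OF xy(2) c g] in \<open>auto simp: Pi_iff\<close>)
    also have "\<dots> = c \<odot>\<^bsub>?F\<^esub> lin_ext R ?F (?L y) x"
      using c xy L by (intro F.lin_ext_fun_smult) auto
    finally show "lin_ext R ?F (?L (c \<odot>\<^bsub>?F\<^esub> y)) x = c \<odot>\<^bsub>?F\<^esub> lin_ext R ?F (?L y) x" .
  next
    fix x y assume "x \<in> carrier ?F" "y \<in> carrier ?F"
    thus "lin_ext R ?F (?L y) x \<in> carrier ?F" using L by (intro F.lin_ext_closed) auto
  qed
  assume st: "s \<in> S" "t \<in> S"
  show "free_gen R s \<otimes>\<^bsub>?A\<^esub> free_gen R t = free_gen R (m s t)"
    unfolding eqs F.lin_ext_gen[OF st(1) L[OF free_gen_closed[OF st(2)]]]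
    by (rule F.lin_ext_gen[OF st(2) g[OF st(1)]])
qed

locale algebra_ideal = nonassoc_algebra K A for K :: "('k, 'm) ring_scheme" and A :: "('k, 'a) module" +
  fixes I
  assumes submodule: "submodule I K A"
    and ideal_left: "\<lbrakk>x \<in> I; y \<in> carrier A\<rbrakk> \<Longrightarrow> x \<otimes>\<^bsub>A\<^esub> y \<in> I"
    and ideal_right: "\<lbrakk>x \<in> carrier A; y \<in> I\<rbrakk> \<Longrightarrow> x \<otimes>\<^bsub>A\<^esub> y \<in> I"
begin

sublocale I: abelian_subgroup I A
  by (rule abelian_subgroupI3)
    (use submodule M.abelian_group_axioms in \<open>auto simp: additive_subgroup_def submodule_def\<close>)

lemma quotient_algebra_coset:
  assumes x: "x \<in> carrier A" and y: "y \<in> carrier A"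
  defines "Q \<equiv> quotient_algebra A I"
  shows "(I +>\<^bsub>A\<^esub> x) \<oplus>\<^bsub>Q\<^esub> (I +>\<^bsub>A\<^esub> y) = I +>\<^bsub>A\<^esub> (x \<oplus>\<^bsub>A\<^esub> y)"
    and "(I +>\<^bsub>A\<^esub> x) \<otimes>\<^bsub>Q\<^esub> (I +>\<^bsub>A\<^esub> y) = I +>\<^bsub>A\<^esub> (x \<otimes>\<^bsub>A\<^esub> y)"
    and "c \<in> carrier K \<Longrightarrow> c \<odot>\<^bsub>Q\<^esub> (I +>\<^bsub>A\<^esub> x) = I +>\<^bsub>A\<^esub> (c \<odot>\<^bsub>A\<^esub> x)"
proof -
  have sub: "I \<subseteq> carrier A" using submoduleE(1)[OF submodule] .
  have coset: "\<exists>h\<in>I. u = h \<oplus>\<^bsub>A\<^esub> v" if "u \<in> I +>\<^bsub>A\<^esub> v" for u v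
    using that by (auto simp: a_r_coset_def')
  have absorb: "I +>\<^bsub>A\<^esub> (h \<oplus>\<^bsub>A\<^esub> v) = I +>\<^bsub>A\<^esub> v" if "h \<in> I" "v \<in> carrier A" for h v
    using that by (intro I.a_repr_independence'[symmetric]) (auto simp: a_r_coset_def')
  show "(I +>\<^bsub>A\<^esub> x) \<oplus>\<^bsub>Q\<^esub> (I +>\<^bsub>A\<^esub> y) = I +>\<^bsub>A\<^esub> (x \<oplus>\<^bsub>A\<^esub> y)"
    using I.a_rcos_sum[OF x y] by (simp add: Q_def quotient_algebra_def)
  have *: "I +>\<^bsub>A\<^esub> (u \<otimes>\<^bsub>A\<^esub> v) = I +>\<^bsub>A\<^esub> (x \<otimes>\<^bsub>A\<^esub> y)"
    if u: "u \<in> I +>\<^bsub>A\<^esub> x" and v: "v \<in> I +>\<^bsub>A\<^esub> y" for u v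
  proof -
    obtain h k where hk: "h \<in> I" "k \<in> I" and uv: "u = h \<oplus>\<^bsub>A\<^esub> x" "v = k \<oplus>\<^bsub>A\<^esub> y"
      using coset[OF u] coset[OF v] by blast
    have cl: "h \<in> carrier A" "k \<in> carrier A" using hk sub by auto
    have "u \<otimes>\<^bsub>A\<^esub> v = (h \<otimes>\<^bsub>A\<^esub> (k \<oplus>\<^bsub>A\<^esub> y) \<oplus>\<^bsub>A\<^esub> x \<otimes>\<^bsub>A\<^esub> k) \<oplus>\<^bsub>A\<^esub> x \<otimes>\<^bsub>A\<^esub> y"
      using cl x y by (simp add: uv mult_add_left mult_add_right mult_closed M.a_ac)
    moreover have "h \<otimes>\<^bsub>A\<^esub> (k \<oplus>\<^bsub>A\<^esub> y) \<oplus>\<^bsub>A\<^esub> x \<otimes>\<^bsub>A\<^esub> k \<in> I"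
      using hk cl x y ideal_left ideal_right by (intro I.a_closed) auto
    ultimately show ?thesis using absorb x y by (simp add: mult_closed)
  qed
  have "x \<in> I +>\<^bsub>A\<^esub> x" "y \<in> I +>\<^bsub>A\<^esub> y" using x y I.a_rcos_self by auto
  hence "(\<Union>u\<in>I +>\<^bsub>A\<^esub> x. \<Union>v\<in>I +>\<^bsub>A\<^esub> y. I +>\<^bsub>A\<^esub> (u \<otimes>\<^bsub>A\<^esub> v)) = I +>\<^bsub>A\<^esub> (x \<otimes>\<^bsub>A\<^esub> y)"
    by (intro SUP_eq_const) (use * in blast)+
  thus "(I +>\<^bsub>A\<^esub> x) \<otimes>\<^bsub>Q\<^esub> (I +>\<^bsub>A\<^esub> y) = I +>\<^bsub>A\<^esub> (x \<otimes>\<^bsub>A\<^esub> y)"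
    by (simp add: Q_def quotient_algebra_def rcoset_mult_def)
  assume c: "c \<in> carrier K"
  have **: "I +>\<^bsub>A\<^esub> (c \<odot>\<^bsub>A\<^esub> u) = I +>\<^bsub>A\<^esub> (c \<odot>\<^bsub>A\<^esub> x)" if u: "u \<in> I +>\<^bsub>A\<^esub> x" for u
  proof -
    obtain h where h: "h \<in> I" "u = h \<oplus>\<^bsub>A\<^esub> x" using coset[OF u] by blast
    have "c \<odot>\<^bsub>A\<^esub> u = c \<odot>\<^bsub>A\<^esub> h \<oplus>\<^bsub>A\<^esub> c \<odot>\<^bsub>A\<^esub> x" using h sub c x by (auto simp: smult_r_distr)
    thus ?thesis using absorb h c x submoduleE(4)[OF submodule] by simp
  qed
  have "(\<Union>u\<in>I +>\<^bsub>A\<^esub> x. I +>\<^bsub>A\<^esub> (c \<odot>\<^bsub>A\<^esub> u)) = I +>\<^bsub>A\<^esub> (c \<odot>\<^bsub>A\<^esub> x)"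
    using \<open>x \<in> I +>\<^bsub>A\<^esub> x\<close> by (intro SUP_eq_const) (use ** in blast)+
  thus "c \<odot>\<^bsub>Q\<^esub> (I +>\<^bsub>A\<^esub> x) = I +>\<^bsub>A\<^esub> (c \<odot>\<^bsub>A\<^esub> x)"
    by (simp add: Q_def quotient_algebra_def)
qed

lemma quotient_algebra: "nonassoc_algebra K (quotient_algebra A I)"
proof -
  let ?Q = "quotient_algebra A I"
  have car: "carrier ?Q = (\<lambda>x. I +>\<^bsub>A\<^esub> x) ` carrier A"
    by (auto simp: quotient_algebra_def A_RCOSETS_def')
  have zero: "\<zero>\<^bsub>?Q\<^esub> = I +>\<^bsub>A\<^esub> \<zero>\<^bsub>A\<^esub>"
    using I.a_rcos_const[of "\<zero>\<^bsub>A\<^esub>"] I.zero_closed by (simp add: quotient_algebra_def)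
  note q = quotient_algebra_coset
  have "module K ?Q"
  proof (rule moduleI)
    show "abelian_group ?Q"
    proof (rule abelian_groupI)
      fix X assume "X \<in> carrier ?Q"
      then obtain x where x: "x \<in> carrier A" "X = I +>\<^bsub>A\<^esub> x" by (auto simp: car)
      show "\<exists>Y\<in>carrier ?Q. Y \<oplus>\<^bsub>?Q\<^esub> X = \<zero>\<^bsub>?Q\<^esub>"
        by (rule bexI[of _ "I +>\<^bsub>A\<^esub> (\<ominus>\<^bsub>A\<^esub> x)"]) (use x in \<open>auto simp: car q zero M.l_neg\<close>)
    qed (auto simp: car q zero M.a_ac)
  qed (auto simp: car q smult_l_distr smult_r_distr smult_assoc1 R.is_cring)
  then interpret Q: module K ?Q .
  show ?thesis
    by unfold_locales
      (auto simp: car q mult_closed mult_add_left mult_add_right mult_smult_left mult_smult_right)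
qed

end

lemma submodule_span:
  fixes R :: "('k, 'm) ring_scheme" and N :: "('k, 'a) module"
  assumes "module R N" "G \<subseteq> carrier N"
  shows "submodule (submodule_span R N G) R N" "G \<subseteq> submodule_span R N G"
    and "\<lbrakk>submodule H R N; G \<subseteq> H\<rbrakk> \<Longrightarrow> submodule_span R N G \<subseteq> H"
proof -
  interpret N: module R N by fact
  have memI: "x \<in> submodule_span R N G" if "\<And>H. \<lbrakk>submodule H R N; G \<subseteq> H\<rbrakk> \<Longrightarrow> x \<in> H" for x
    using that by (simp add: submodule_span_def)
  have memD: "x \<in> H" if "x \<in> submodule_span R N G" "submodule H R N" "G \<subseteq> H" for x H
    using that by (simp add: submodule_span_def)
  show "submodule (submodule_span R N G) R N"
  proof (rule N.submoduleI)
    show "submodule_span R N G \<subseteq> carrier N"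
      using N.carrier_is_submodule assms(2) by (auto simp: submodule_span_def)
  next
    show "\<zero>\<^bsub>N\<^esub> \<in> submodule_span R N G"
      unfolding submodule_span_def submodule_def using subgroup.one_closed by force
  next
    fix a assume a: "a \<in> submodule_span R N G"
    show "\<ominus>\<^bsub>N\<^esub> a \<in> submodule_span R N G"
    proof (rule memI)
      fix H assume H: "submodule H R N" "G \<subseteq> H"
      show "\<ominus>\<^bsub>N\<^esub> a \<in> H" by (rule N.submoduleE(3)[OF H(1) memD[OF a H]])
    qed
    fix b assume b: "b \<in> submodule_span R N G"
    show "a \<oplus>\<^bsub>N\<^esub> b \<in> submodule_span R N G"
    proof (rule memI)
      fix H assume H: "submodule H R N" "G \<subseteq> H"
      show "a \<oplus>\<^bsub>N\<^esub> b \<in> H" by (rule N.submoduleE(5)[OF H(1) memD[OF a H] memD[OF b H]])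
    qed
  next
    fix c x assume c: "c \<in> carrier R" and x: "x \<in> submodule_span R N G"
    show "c \<odot>\<^bsub>N\<^esub> x \<in> submodule_span R N G"
    proof (rule memI)
      fix H assume H: "submodule H R N" "G \<subseteq> H"
      show "c \<odot>\<^bsub>N\<^esub> x \<in> H" by (rule N.submoduleE(4)[OF H(1) c memD[OF x H]])
    qed
  qed
  show "G \<subseteq> submodule_span R N G"
    by (intro subsetI memI) (rule subsetD)
  show "submodule_span R N G \<subseteq> H" if "submodule H R N" "G \<subseteq> H"
    using memD[OF _ that] by (rule subsetI)
qed

locale algebra_pair =
  A: nonassoc_algebra K A + B: nonassoc_algebra K B
  for K :: "('k, 'm) ring_scheme" and A :: "('k, 'a) module" and B :: "('k, 'b) module"
begin

abbreviation "F \<equiv> tensor_free K A B"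
abbreviation "g \<equiv> free_gen K"

sublocale F: nonassoc_algebra K F
  unfolding tensor_free_def
  by (rule A.R.free_algebra) (auto simp: A.mult_closed B.mult_closed)

lemma gen_closed: "\<lbrakk>a \<in> carrier A; b \<in> carrier B\<rbrakk> \<Longrightarrow> g (a, b) \<in> carrier F"
  by (simp add: tensor_free_def free_algebra_def A.R.free_gen_closed)

lemma gen_mult:
  "\<lbrakk>a \<in> carrier A; b \<in> carrier B; a' \<in> carrier A; b' \<in> carrier B\<rbrakk> \<Longrightarrow>
    g (a, b) \<otimes>\<^bsub>F\<^esub> g (a', b') = g (a \<otimes>\<^bsub>A\<^esub> a', b \<otimes>\<^bsub>B\<^esub> b')"
  unfolding tensor_free_def
  by (subst A.R.free_algebra) (auto simp: A.mult_closed B.mult_closed)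

lemma submodule_eq_carrier:
  assumes "submodule H K F" "\<And>a b. \<lbrakk>a \<in> carrier A; b \<in> carrier B\<rbrakk> \<Longrightarrow> g (a, b) \<in> H"
  shows "H = carrier F"
proof -
  have "H = carrier (free_module K (carrier A \<times> carrier B))"
    by (rule A.R.free_module_submodule_eq)
      (use assms in \<open>auto simp: tensor_free_def free_algebra_def submodule_mult_update\<close>)
  thus ?thesis by (simp add: tensor_free_def free_algebra_def)
qed

lemma gens_closed: "tensor_gens K A B \<subseteq> carrier F"
  by (auto simp: tensor_gens_def Let_def gen_closed)

lemmas rel = submodule_span[OF F.module_axioms gens_closed, folded tensor_rel_def]

lemma minus_mult:
  "\<lbrakk>x \<in> carrier F; y \<in> carrier F; z \<in> carrier F\<rbrakk> \<Longrightarrow>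
    (x \<ominus>\<^bsub>F\<^esub> y) \<otimes>\<^bsub>F\<^esub> z = x \<otimes>\<^bsub>F\<^esub> z \<ominus>\<^bsub>F\<^esub> y \<otimes>\<^bsub>F\<^esub> z"
  using F.mult_add_left[of x "\<ominus>\<^bsub>F\<^esub> y" z] F.mult_smult_left[of "\<ominus>\<^bsub>K\<^esub> \<one>\<^bsub>K\<^esub>" y z]
  by (simp add: F.M.minus_eq F.smult_l_minus F.mult_closed)

lemma mult_minus:
  "\<lbrakk>x \<in> carrier F; y \<in> carrier F; z \<in> carrier F\<rbrakk> \<Longrightarrow>
    z \<otimes>\<^bsub>F\<^esub> (x \<ominus>\<^bsub>F\<^esub> y) = z \<otimes>\<^bsub>F\<^esub> x \<ominus>\<^bsub>F\<^esub> z \<otimes>\<^bsub>F\<^esub> y"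
  using F.mult_add_right[of z x "\<ominus>\<^bsub>F\<^esub> y"] F.mult_smult_right[of "\<ominus>\<^bsub>K\<^esub> \<one>\<^bsub>K\<^esub>" z y]
  by (simp add: F.M.minus_eq F.smult_l_minus F.mult_closed)

lemma gensI:
  assumes "a \<in> carrier A" "b \<in> carrier B"
  shows "a' \<in> carrier A \<Longrightarrow> g (a \<oplus>\<^bsub>A\<^esub> a', b) \<ominus>\<^bsub>F\<^esub> (g (a, b) \<oplus>\<^bsub>F\<^esub> g (a', b)) \<in> tensor_gens K A B"
    and "b' \<in> carrier B \<Longrightarrow> g (a, b \<oplus>\<^bsub>B\<^esub> b') \<ominus>\<^bsub>F\<^esub> (g (a, b) \<oplus>\<^bsub>F\<^esub> g (a, b')) \<in> tensor_gens K A B"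
    and "c \<in> carrier K \<Longrightarrow> g (c \<odot>\<^bsub>A\<^esub> a, b) \<ominus>\<^bsub>F\<^esub> c \<odot>\<^bsub>F\<^esub> g (a, b) \<in> tensor_gens K A B"
    and "c \<in> carrier K \<Longrightarrow> g (a, c \<odot>\<^bsub>B\<^esub> b) \<ominus>\<^bsub>F\<^esub> c \<odot>\<^bsub>F\<^esub> g (a, b) \<in> tensor_gens K A B"
  using assms unfolding tensor_gens_def Let_def by blast+

lemma gensE:
  assumes "x \<in> tensor_gens K A B"
  obtains
    (1) a a' b where "a \<in> carrier A" "a' \<in> carrier A" "b \<in> carrier B"
      "x = g (a \<oplus>\<^bsub>A\<^esub> a', b) \<ominus>\<^bsub>F\<^esub> (g (a, b) \<oplus>\<^bsub>F\<^esub> g (a', b))"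
  | (2) a b b' where "a \<in> carrier A" "b \<in> carrier B" "b' \<in> carrier B"
      "x = g (a, b \<oplus>\<^bsub>B\<^esub> b') \<ominus>\<^bsub>F\<^esub> (g (a, b) \<oplus>\<^bsub>F\<^esub> g (a, b'))"
  | (3) c a b where "c \<in> carrier K" "a \<in> carrier A" "b \<in> carrier B"
      "x = g (c \<odot>\<^bsub>A\<^esub> a, b) \<ominus>\<^bsub>F\<^esub> c \<odot>\<^bsub>F\<^esub> g (a, b)"
  | (4) c a b where "c \<in> carrier K" "a \<in> carrier A" "b \<in> carrier B"
      "x = g (a, c \<odot>\<^bsub>B\<^esub> b) \<ominus>\<^bsub>F\<^esub> c \<odot>\<^bsub>F\<^esub> g (a, b)"
  using assms unfolding tensor_gens_def Let_def Un_iff mem_Collect_eq by (elim disjE exE conjE) metis+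

lemma gens_mult_gen:
  assumes "x \<in> tensor_gens K A B" "u \<in> carrier A" "v \<in> carrier B"
  shows "x \<otimes>\<^bsub>F\<^esub> g (u, v) \<in> tensor_gens K A B" "g (u, v) \<otimes>\<^bsub>F\<^esub> x \<in> tensor_gens K A B"
proof -
  note simps = minus_mult mult_minus gen_closed gen_mult F.mult_add_left F.mult_add_right
      F.mult_smult_left F.mult_smult_right A.mult_add_left A.mult_add_right A.mult_smult_left
      A.mult_smult_right B.mult_add_left B.mult_add_right B.mult_smult_left B.mult_smult_right
      A.mult_closed B.mult_closed
  from assms(1) have "x \<otimes>\<^bsub>F\<^esub> g (u, v) \<in> tensor_gens K A B \<and> g (u, v) \<otimes>\<^bsub>F\<^esub> x \<in> tensor_gens K A B"
    by (cases rule: gensE) (use assms(2,3) in \<open>simp_all add: simps gensI\<close>)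
  thus "x \<otimes>\<^bsub>F\<^esub> g (u, v) \<in> tensor_gens K A B" "g (u, v) \<otimes>\<^bsub>F\<^esub> x \<in> tensor_gens K A B" by auto
qed

lemma rel_ideal: "algebra_ideal K F (tensor_rel K A B)"
proof -
  let ?I = "tensor_rel K A B"
  note E = F.submoduleE(3-5)[OF rel(1)]
  have m0: "x \<otimes>\<^bsub>F\<^esub> \<zero>\<^bsub>F\<^esub> = \<zero>\<^bsub>F\<^esub>" "\<zero>\<^bsub>F\<^esub> \<otimes>\<^bsub>F\<^esub> x = \<zero>\<^bsub>F\<^esub>" if "x \<in> carrier F" for x
    using that F.mult_smult_right[of "\<zero>\<^bsub>K\<^esub>" x x] F.mult_smult_left[of "\<zero>\<^bsub>K\<^esub>" x x]
    by (simp_all add: F.mult_closed)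
  have mneg: "x \<otimes>\<^bsub>F\<^esub> (\<ominus>\<^bsub>F\<^esub> y) = \<ominus>\<^bsub>F\<^esub> (x \<otimes>\<^bsub>F\<^esub> y)" "(\<ominus>\<^bsub>F\<^esub> x) \<otimes>\<^bsub>F\<^esub> y = \<ominus>\<^bsub>F\<^esub> (x \<otimes>\<^bsub>F\<^esub> y)"
    if "x \<in> carrier F" "y \<in> carrier F" for x y
    using that F.mult_smult_right[of "\<ominus>\<^bsub>K\<^esub> \<one>\<^bsub>K\<^esub>" x y] F.mult_smult_left[of "\<ominus>\<^bsub>K\<^esub> \<one>\<^bsub>K\<^esub>" x y]
    by (simp_all add: F.mult_closed F.smult_l_minus)
  have z: "\<zero>\<^bsub>F\<^esub> \<in> ?I"
    using subgroup.one_closed[OF submodule.axioms(1)[OF rel(1)]] by simp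
  note ms = F.mult_add_left F.mult_add_right F.mult_smult_left F.mult_smult_right F.mult_closed m0 mneg z
  have I: "x \<otimes>\<^bsub>F\<^esub> y \<in> ?I \<and> y \<otimes>\<^bsub>F\<^esub> x \<in> ?I" if x: "x \<in> tensor_gens K A B" and y: "y \<in> carrier F" for x y
  proof -
    have xc: "x \<in> carrier F" using x gens_closed by auto
    let ?H = "{y \<in> carrier F. x \<otimes>\<^bsub>F\<^esub> y \<in> ?I \<and> y \<otimes>\<^bsub>F\<^esub> x \<in> ?I}"
    have "?H = carrier F"
    proof (rule submodule_eq_carrier)
      show "submodule ?H K F"
        by (rule F.submoduleI) (auto simp: ms xc E)
    qed (use gens_mult_gen[OF x] rel(2) gen_closed in auto)
    thus ?thesis using y by blast
  qed
  let ?H = "{x \<in> carrier F. \<forall>y\<in>carrier F. x \<otimes>\<^bsub>F\<^esub> y \<in> ?I \<and> y \<otimes>\<^bsub>F\<^esub> x \<in> ?I}"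
  have "?I \<subseteq> ?H"
  proof (rule rel(3))
    show "submodule ?H K F"
      by (rule F.submoduleI) (auto simp: ms E)
  qed (use I gens_closed in auto)
  thus ?thesis
    by (intro algebra_ideal.intro algebra_ideal_axioms.intro F.nonassoc_algebra_axioms rel(1)) auto
qed

sublocale I: algebra_ideal K F "tensor_rel K A B" by (rule rel_ideal)

lemma tensor_algebra: "nonassoc_algebra K (tensor K A B)"
  unfolding tensor_def by (rule I.quotient_algebra)

lemma pure_tensor_closed:
  "\<lbrakk>a \<in> carrier A; b \<in> carrier B\<rbrakk> \<Longrightarrow> pure_tensor K A B a b \<in> carrier (tensor K A B)"
  using gen_closed by (auto simp: pure_tensor_def tensor_def quotient_algebra_def A_RCOSETS_def')

lemma pure_tensor_mult:
  assumes "a \<in> carrier A" "b \<in> carrier B" "a' \<in> carrier A" "b' \<in> carrier B"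
  shows "pure_tensor K A B a b \<otimes>\<^bsub>tensor K A B\<^esub> pure_tensor K A B a' b' =
    pure_tensor K A B (a \<otimes>\<^bsub>A\<^esub> a') (b \<otimes>\<^bsub>B\<^esub> b')"
  using assms by (simp add: pure_tensor_def tensor_def I.quotient_algebra_coset gen_closed gen_mult)

lemma coset_eqI:
  assumes "x \<in> carrier F" "y \<in> carrier F" "x \<ominus>\<^bsub>F\<^esub> y \<in> tensor_gens K A B"
  shows "tensor_rel K A B +>\<^bsub>F\<^esub> x = tensor_rel K A B +>\<^bsub>F\<^esub> y"
  using assms rel(2) I.I.a_rcos_module_rev[of y x]
  by (intro I.I.a_repr_independence'[symmetric]) (auto simp: F.M.minus_eq)

lemma pure_tensor_bilinear:
  assumes "a \<in> carrier A" "b \<in> carrier B"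
  shows "a' \<in> carrier A \<Longrightarrow> pure_tensor K A B (a \<oplus>\<^bsub>A\<^esub> a') b =
      pure_tensor K A B a b \<oplus>\<^bsub>tensor K A B\<^esub> pure_tensor K A B a' b"
    and "b' \<in> carrier B \<Longrightarrow> pure_tensor K A B a (b \<oplus>\<^bsub>B\<^esub> b') =
      pure_tensor K A B a b \<oplus>\<^bsub>tensor K A B\<^esub> pure_tensor K A B a b'"
    and "c \<in> carrier K \<Longrightarrow> pure_tensor K A B (c \<odot>\<^bsub>A\<^esub> a) b = c \<odot>\<^bsub>tensor K A B\<^esub> pure_tensor K A B a b"
    and "c \<in> carrier K \<Longrightarrow> pure_tensor K A B a (c \<odot>\<^bsub>B\<^esub> b) = c \<odot>\<^bsub>tensor K A B\<^esub> pure_tensor K A B a b"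
  unfolding pure_tensor_def tensor_def using assms
  by (simp_all add: I.quotient_algebra_coset(1) I.quotient_algebra_coset(3)[OF _ F.M.zero_closed]
      gen_closed coset_eqI gensI)

lemma tensor_universal:
  fixes M :: "('k, 'c) module"
  assumes M: "module K M"
    and closed: "\<And>a b. \<lbrakk>a \<in> carrier A; b \<in> carrier B\<rbrakk> \<Longrightarrow> h a b \<in> carrier M"
    and add: "\<And>a a' b. \<lbrakk>a \<in> carrier A; a' \<in> carrier A; b \<in> carrier B\<rbrakk> \<Longrightarrow>
        h (a \<oplus>\<^bsub>A\<^esub> a') b = h a b \<oplus>\<^bsub>M\<^esub> h a' b"
      "\<And>a b b'. \<lbrakk>a \<in> carrier A; b \<in> carrier B; b' \<in> carrier B\<rbrakk> \<Longrightarrow>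
        h a (b \<oplus>\<^bsub>B\<^esub> b') = h a b \<oplus>\<^bsub>M\<^esub> h a b'"
    and smult: "\<And>c a b. \<lbrakk>c \<in> carrier K; a \<in> carrier A; b \<in> carrier B\<rbrakk> \<Longrightarrow>
        h (c \<odot>\<^bsub>A\<^esub> a) b = c \<odot>\<^bsub>M\<^esub> h a b"
      "\<And>c a b. \<lbrakk>c \<in> carrier K; a \<in> carrier A; b \<in> carrier B\<rbrakk> \<Longrightarrow>
        h a (c \<odot>\<^bsub>B\<^esub> b) = c \<odot>\<^bsub>M\<^esub> h a b"
  defines "T \<equiv> tensor K A B"
  obtains f where "f \<in> carrier T \<rightarrow> carrier M"
    "\<And>x y. \<lbrakk>x \<in> carrier T; y \<in> carrier T\<rbrakk> \<Longrightarrow> f (x \<oplus>\<^bsub>T\<^esub> y) = f x \<oplus>\<^bsub>M\<^esub> f y"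
    "\<And>c x. \<lbrakk>c \<in> carrier K; x \<in> carrier T\<rbrakk> \<Longrightarrow> f (c \<odot>\<^bsub>T\<^esub> x) = c \<odot>\<^bsub>M\<^esub> f x"
    "\<And>a b. \<lbrakk>a \<in> carrier A; b \<in> carrier B\<rbrakk> \<Longrightarrow> f (pure_tensor K A B a b) = h a b"
proof -
  interpret M: module K M by fact
  let ?I = "tensor_rel K A B"
  let ?S = "carrier A \<times> carrier B"
  let ?h = "\<lambda>(a, b). h a b"
  define L where "L = lin_ext K M ?h"
  have eqs: "carrier F = carrier (free_module K ?S)" "add F = add (free_module K ?S)"
      "smult F = smult (free_module K ?S)"
    by (simp_all add: tensor_free_def free_algebra_def)
  have h: "?h \<in> ?S \<rightarrow> carrier M" using closed by auto
  have Lc: "L x \<in> carrier M" if "x \<in> carrier F" for x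
    using M.lin_ext_closed[OF _ h] that unfolding L_def eqs by auto
  have La: "L (x \<oplus>\<^bsub>F\<^esub> y) = L x \<oplus>\<^bsub>M\<^esub> L y" if "x \<in> carrier F" "y \<in> carrier F" for x y
    using M.lin_ext_add[OF _ _ h] that unfolding L_def eqs by auto
  have Ls: "L (c \<odot>\<^bsub>F\<^esub> x) = c \<odot>\<^bsub>M\<^esub> L x" if "c \<in> carrier K" "x \<in> carrier F" for c x
    using M.lin_ext_smult[OF _ _ h] that unfolding L_def eqs by auto
  have Lg: "L (g (a, b)) = h a b" if "a \<in> carrier A" "b \<in> carrier B" for a b
    using M.lin_ext_gen[OF _ h, of "(a, b)"] that unfolding L_def by auto
  have L0: "L \<zero>\<^bsub>F\<^esub> = \<zero>\<^bsub>M\<^esub>"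
    using Ls[of "\<zero>\<^bsub>K\<^esub>" "\<zero>\<^bsub>F\<^esub>"] Lc[of "\<zero>\<^bsub>F\<^esub>"] by simp
  have Ln: "L (\<ominus>\<^bsub>F\<^esub> x) = \<ominus>\<^bsub>M\<^esub> L x" if "x \<in> carrier F" for x
    using Ls[of "\<ominus>\<^bsub>K\<^esub> \<one>\<^bsub>K\<^esub>" x] Lc[of x] that by (simp add: F.smult_l_minus M.smult_l_minus)
  have "?I \<subseteq> {x \<in> carrier F. L x = \<zero>\<^bsub>M\<^esub>}" (is "_ \<subseteq> ?H")
  proof (rule rel(3))
    show "submodule ?H K F"
      by (rule F.submoduleI) (auto simp: L0 La Ls Ln)
    show "tensor_gens K A B \<subseteq> ?H"
    proof
      fix x assume x: "x \<in> tensor_gens K A B"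
      hence "L x = \<zero>\<^bsub>M\<^esub>"
        by (cases rule: gensE)
          (simp_all add: F.M.minus_eq La Ls Ln Lg gen_closed closed add smult M.M.r_neg)
      thus "x \<in> ?H" using x gens_closed by auto
    qed
  qed
  hence LI: "L (i \<oplus>\<^bsub>F\<^esub> x) = L x" if "i \<in> ?I" "x \<in> carrier F" for i x
    using that La[of i x] Lc[of x] by auto
  define f where "f X = L (SOME x. x \<in> X)" for X
  have f: "f (?I +>\<^bsub>F\<^esub> x) = L x" if x: "x \<in> carrier F" for x
  proof -
    have "(SOME u. u \<in> ?I +>\<^bsub>F\<^esub> x) \<in> ?I +>\<^bsub>F\<^esub> x"
      by (rule someI[of "\<lambda>u. u \<in> ?I +>\<^bsub>F\<^esub> x", OF I.I.a_rcos_self[OF x]])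
    then obtain i where "i \<in> ?I" "(SOME u. u \<in> ?I +>\<^bsub>F\<^esub> x) = i \<oplus>\<^bsub>F\<^esub> x"
      by (auto simp: a_r_coset_def')
    thus ?thesis using LI[OF _ x] by (simp add: f_def)
  qed
  have car: "carrier T = (\<lambda>x. ?I +>\<^bsub>F\<^esub> x) ` carrier F"
    by (auto simp: T_def tensor_def quotient_algebra_def A_RCOSETS_def')
  note q = I.quotient_algebra_coset(1) I.quotient_algebra_coset(3)[OF _ F.M.zero_closed]
  show thesis
  proof (rule that)
    show "f \<in> carrier T \<rightarrow> carrier M" by (auto simp: car f Lc)
    show "f (x \<oplus>\<^bsub>T\<^esub> y) = f x \<oplus>\<^bsub>M\<^esub> f y" if "x \<in> carrier T" "y \<in> carrier T" for x y
      using that unfolding car by (auto simp: T_def tensor_def q f La)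
    show "f (c \<odot>\<^bsub>T\<^esub> x) = c \<odot>\<^bsub>M\<^esub> f x" if "c \<in> carrier K" "x \<in> carrier T" for c x
      using that unfolding car by (auto simp: T_def tensor_def q f Ls)
    show "f (pure_tensor K A B a b) = h a b" if "a \<in> carrier A" "b \<in> carrier B" for a b
      using that by (simp add: pure_tensor_def f gen_closed Lg)
  qed
qed

end

end

theory Submission
  imports Defs
begin

text \<open>
  Let \<open>E\<close> be a three-dimensional algebra over \<open>K\<close> with a basis \<open>u1, u2, u3\<close> whose products
  are \<open>ui ui = 0\<close>, \<open>ui uj = 1/2 uk\<close> and \<open>uj ui = s/2 uk\<close> for every cyclic rotation \<open>(i, j, k)\<close> of
  \<open>(1, 2, 3)\<close>, where \<open>s\<close> is a scalar. If \<open>y x = s (x y)\<close> holds in \<open>A\<close>, then in \<open>E \<otimes> A\<close>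

    \<open>(u2 \<otimes> x2) (u3 \<otimes> y3) + (u3 \<otimes> x3) (u2 \<otimes> y2) = u1 \<otimes> 1/2 (x2 y3 + s (x3 y2))
      = u1 \<otimes> 1/2 (x2 y3 + y2 x3)\<close>,

  which is the first coordinate of the product of the triple. Hence
  \<open>(x1, x2, x3) \<mapsto> u1 \<otimes> x1 + u2 \<otimes> x2 + u3 \<otimes> x3\<close> is multiplicative, and it is bijective because
  \<open>u1, u2, u3\<close> is a basis: the coordinate functionals induce its inverse through the universal
  property of the tensor product.

  Both parts of the theorem exhibit such a basis. In \<open>so(3)\<close> it is \<open>ui = 1/2 ei\<close>, with \<open>s = -1\<close>.
  In the simplicial algebra \<open>s = 1\<close>, and the basis is found from the idempotents of the triple
  of \<open>K\<close>: the nonzero solutions of \<open>x1 = x2 x3\<close>, \<open>x2 = x3 x1\<close>, \<open>x3 = x1 x2\<close> are \<open>(1,1,1)\<close>,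
  \<open>(1,-1,-1)\<close>, \<open>(-1,1,-1)\<close> and \<open>(-1,-1,1)\<close>. They satisfy the relations of
  \<open>\<gamma>0, \<gamma>1, \<gamma>2, \<gamma>3\<close>, and solving for the standard basis vectors gives \<open>ui = -1/2 (\<gamma>j + \<gamma>k)\<close>.
\<close>

section \<open>Tensoring with a three-dimensional algebra\<close>

text \<open>
  The vectors of the free module on whose cosets the two maps agree form a submodule. It contains
  the free generators, which represent the pure tensors, so it is everything. This is the
  uniqueness half of the universal property of the tensor product.
\<close>

lemma (in algebra_pair) tensor_linear_eqI:
  fixes M :: "('k, 'c) module"
  defines "T \<equiv> tensor K A B"
  assumes M: "module K M"
    and p: "\<And>x. x \<in> carrier T \<Longrightarrow> p x \<in> carrier M"
      "\<And>x y. \<lbrakk>x \<in> carrier T; y \<in> carrier T\<rbrakk> \<Longrightarrow> p (x \<oplus>\<^bsub>T\<^esub> y) = p x \<oplus>\<^bsub>M\<^esub> p y"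
      "\<And>c x. \<lbrakk>c \<in> carrier K; x \<in> carrier T\<rbrakk> \<Longrightarrow> p (c \<odot>\<^bsub>T\<^esub> x) = c \<odot>\<^bsub>M\<^esub> p x"
    and q: "\<And>x. x \<in> carrier T \<Longrightarrow> q x \<in> carrier M"
      "\<And>x y. \<lbrakk>x \<in> carrier T; y \<in> carrier T\<rbrakk> \<Longrightarrow> q (x \<oplus>\<^bsub>T\<^esub> y) = q x \<oplus>\<^bsub>M\<^esub> q y"
      "\<And>c x. \<lbrakk>c \<in> carrier K; x \<in> carrier T\<rbrakk> \<Longrightarrow> q (c \<odot>\<^bsub>T\<^esub> x) = c \<odot>\<^bsub>M\<^esub> q x"
    and eq: "\<And>a b. \<lbrakk>a \<in> carrier A; b \<in> carrier B\<rbrakk> \<Longrightarrow>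
      p (pure_tensor K A B a b) = q (pure_tensor K A B a b)"
    and x: "x \<in> carrier T"
  shows "p x = q x"
proof -
  interpret M: module K M by fact
  let ?\<pi> = "\<lambda>x. tensor_rel K A B +>\<^bsub>F\<^esub> x"
  have car: "carrier T = ?\<pi> ` carrier F"
    by (auto simp: T_def tensor_def quotient_algebra_def A_RCOSETS_def')
  note \<pi> = I.quotient_algebra_coset(1)[folded tensor_def T_def]
    I.quotient_algebra_coset(3)[OF _ F.M.zero_closed, folded tensor_def T_def]
  have \<pi>_closed: "?\<pi> x \<in> carrier T" if "x \<in> carrier F" for x
    using that by (auto simp: car)
  have add: "p (?\<pi> (x \<oplus>\<^bsub>F\<^esub> y)) = p (?\<pi> x) \<oplus>\<^bsub>M\<^esub> p (?\<pi> y)"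
    "q (?\<pi> (x \<oplus>\<^bsub>F\<^esub> y)) = q (?\<pi> x) \<oplus>\<^bsub>M\<^esub> q (?\<pi> y)"
    if "x \<in> carrier F" "y \<in> carrier F" for x y
    using that p(2) q(2) \<pi>_closed by (simp_all flip: \<pi>(1))
  have smult: "p (?\<pi> (c \<odot>\<^bsub>F\<^esub> x)) = c \<odot>\<^bsub>M\<^esub> p (?\<pi> x)"
    "q (?\<pi> (c \<odot>\<^bsub>F\<^esub> x)) = c \<odot>\<^bsub>M\<^esub> q (?\<pi> x)"
    if "c \<in> carrier K" "x \<in> carrier F" for c x
    using that p(3) q(3) \<pi>_closed by (simp_all flip: \<pi>(2))
  let ?H = "{x \<in> carrier F. p (?\<pi> x) = q (?\<pi> x)}"
  have "?H = carrier F"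
  proof (rule submodule_eq_carrier)
    show "submodule ?H K F"
    proof (rule F.submoduleI)
      show "\<zero>\<^bsub>F\<^esub> \<in> ?H"
        using smult[of "\<zero>\<^bsub>K\<^esub>" "\<zero>\<^bsub>F\<^esub>"] p(1) q(1) \<pi>_closed by simp
      show "\<ominus>\<^bsub>F\<^esub> a \<in> ?H" if "a \<in> ?H" for a
        using that smult[of "\<ominus>\<^bsub>K\<^esub> \<one>\<^bsub>K\<^esub>" a] by (simp add: F.smult_l_minus)
    qed (auto simp: add smult)
    show "free_gen K (a, b) \<in> ?H" if "a \<in> carrier A" "b \<in> carrier B" for a b
      using that eq gen_closed by (simp add: pure_tensor_def)
  qed
  thus ?thesis using x by (auto simp: car)
qed

text \<open>
  The basis is a parameter, although \<open>so(3)\<close> and the simplicial algebra come with a standard one: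
  their products take the shape of the product of a triple only in another basis. The functionals
  \<open>l1, l2, l3\<close> are the dual basis.
\<close>

locale framed_pair = algebra_pair K E A
  for K :: "('k, 'm) ring_scheme" and E :: "('k, 'e) module" and A :: "('k, 'a) module" +
  fixes u1 u2 u3 :: 'e and l1 l2 l3 :: "'e \<Rightarrow> 'k"
  assumes u_closed: "u1 \<in> carrier E" "u2 \<in> carrier E" "u3 \<in> carrier E"
    and l_closed: "x \<in> carrier E \<Longrightarrow> l1 x \<in> carrier K"
      "x \<in> carrier E \<Longrightarrow> l2 x \<in> carrier K" "x \<in> carrier E \<Longrightarrow> l3 x \<in> carrier K"
    and l_add: "\<lbrakk>x \<in> carrier E; y \<in> carrier E\<rbrakk> \<Longrightarrow> l1 (x \<oplus>\<^bsub>E\<^esub> y) = l1 x \<oplus>\<^bsub>K\<^esub> l1 y"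
      "\<lbrakk>x \<in> carrier E; y \<in> carrier E\<rbrakk> \<Longrightarrow> l2 (x \<oplus>\<^bsub>E\<^esub> y) = l2 x \<oplus>\<^bsub>K\<^esub> l2 y"
      "\<lbrakk>x \<in> carrier E; y \<in> carrier E\<rbrakk> \<Longrightarrow> l3 (x \<oplus>\<^bsub>E\<^esub> y) = l3 x \<oplus>\<^bsub>K\<^esub> l3 y"
    and l_smult: "\<lbrakk>c \<in> carrier K; x \<in> carrier E\<rbrakk> \<Longrightarrow> l1 (c \<odot>\<^bsub>E\<^esub> x) = c \<otimes>\<^bsub>K\<^esub> l1 x"
      "\<lbrakk>c \<in> carrier K; x \<in> carrier E\<rbrakk> \<Longrightarrow> l2 (c \<odot>\<^bsub>E\<^esub> x) = c \<otimes>\<^bsub>K\<^esub> l2 x"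
      "\<lbrakk>c \<in> carrier K; x \<in> carrier E\<rbrakk> \<Longrightarrow> l3 (c \<odot>\<^bsub>E\<^esub> x) = c \<otimes>\<^bsub>K\<^esub> l3 x"
    and l_u: "l1 u1 = \<one>\<^bsub>K\<^esub>" "l1 u2 = \<zero>\<^bsub>K\<^esub>" "l1 u3 = \<zero>\<^bsub>K\<^esub>"
      "l2 u1 = \<zero>\<^bsub>K\<^esub>" "l2 u2 = \<one>\<^bsub>K\<^esub>" "l2 u3 = \<zero>\<^bsub>K\<^esub>"
      "l3 u1 = \<zero>\<^bsub>K\<^esub>" "l3 u2 = \<zero>\<^bsub>K\<^esub>" "l3 u3 = \<one>\<^bsub>K\<^esub>"
    and expand: "x \<in> carrier E \<Longrightarrow>
      x = l1 x \<odot>\<^bsub>E\<^esub> u1 \<oplus>\<^bsub>E\<^esub> (l2 x \<odot>\<^bsub>E\<^esub> u2 \<oplus>\<^bsub>E\<^esub> l3 x \<odot>\<^bsub>E\<^esub> u3)"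
begin

abbreviation "T \<equiv> tensor K E A"
abbreviation "pt \<equiv> pure_tensor K E A"

sublocale T: nonassoc_algebra K T by (rule tensor_algebra)

definition combine :: "'a \<times> 'a \<times> 'a \<Rightarrow> ('e \<times> 'a \<Rightarrow> 'k) set" where
  "combine = (\<lambda>(x1, x2, x3). pt u1 x1 \<oplus>\<^bsub>T\<^esub> (pt u2 x2 \<oplus>\<^bsub>T\<^esub> pt u3 x3))"

lemmas u_pure_tensor = pure_tensor_closed[OF u_closed(1)] pure_tensor_closed[OF u_closed(2)]
  pure_tensor_closed[OF u_closed(3)]

lemma combine_closed:
  "x \<in> carrier (cube A m) \<Longrightarrow> combine x \<in> carrier T"
  by (auto simp: combine_def cube_def u_pure_tensor)

lemma combine_add:
  "\<lbrakk>x \<in> carrier (cube A m); y \<in> carrier (cube A m)\<rbrakk> \<Longrightarrow>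
    combine (x \<oplus>\<^bsub>cube A m\<^esub> y) = combine x \<oplus>\<^bsub>T\<^esub> combine y"
  by (auto simp: combine_def cube_def u_pure_tensor pure_tensor_bilinear(2) u_closed T.M.a_ac)

lemma combine_smult:
  "\<lbrakk>c \<in> carrier K; x \<in> carrier (cube A m)\<rbrakk> \<Longrightarrow>
    combine (c \<odot>\<^bsub>cube A m\<^esub> x) = c \<odot>\<^bsub>T\<^esub> combine x"
  by (auto simp: combine_def cube_def u_pure_tensor pure_tensor_bilinear(4) u_closed
      T.smult_r_distr)

text \<open>
  The inverse is induced by the bilinear map \<open>(e, a) \<mapsto> (l1 e a, l2 e a, l3 e a)\<close>.
\<close>

lemma combine_bij: "bij_betw combine (carrier (cube A m)) (carrier T)"
proof -
  let ?C = "cube A m"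
  let ?h = "\<lambda>e a. (l1 e \<odot>\<^bsub>A\<^esub> a, l2 e \<odot>\<^bsub>A\<^esub> a, l3 e \<odot>\<^bsub>A\<^esub> a)"
  have C: "module K ?C" by (rule cube_module[OF B.module_axioms])
  have h_closed: "?h e a \<in> carrier ?C" if "e \<in> carrier E" "a \<in> carrier A" for e a
    using that by (simp add: cube_def l_closed)
  obtain f where f: "f \<in> carrier T \<rightarrow> carrier ?C"
    "\<And>x y. \<lbrakk>x \<in> carrier T; y \<in> carrier T\<rbrakk> \<Longrightarrow> f (x \<oplus>\<^bsub>T\<^esub> y) = f x \<oplus>\<^bsub>?C\<^esub> f y"
    "\<And>c x. \<lbrakk>c \<in> carrier K; x \<in> carrier T\<rbrakk> \<Longrightarrow> f (c \<odot>\<^bsub>T\<^esub> x) = c \<odot>\<^bsub>?C\<^esub> f x"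
    "\<And>e a. \<lbrakk>e \<in> carrier E; a \<in> carrier A\<rbrakk> \<Longrightarrow> f (pt e a) = ?h e a"
  proof (rule tensor_universal[OF C, of ?h])
    show "?h (c \<odot>\<^bsub>E\<^esub> e) a = c \<odot>\<^bsub>?C\<^esub> ?h e a" "?h e (c \<odot>\<^bsub>A\<^esub> a) = c \<odot>\<^bsub>?C\<^esub> ?h e a"
      if "c \<in> carrier K" "e \<in> carrier E" "a \<in> carrier A" for c e a
      using that
      by (simp_all add: cube_def l_smult l_closed A.R.m_comm flip: B.smult_assoc1)
  qed (auto simp: h_closed cube_def l_add l_closed B.smult_l_distr B.smult_r_distr)
  have f_closed: "f t \<in> carrier ?C" if "t \<in> carrier T" for t
    using f(1) that by auto
  show ?thesis
  proof (rule bij_betw_byWitness[where f' = f])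
    show "\<forall>x\<in>carrier ?C. f (combine x) = x"
      by (auto simp: combine_def cube_def u_pure_tensor u_closed f l_u)
    show "\<forall>t\<in>carrier T. combine (f t) = t"
    proof
      fix t assume t: "t \<in> carrier T"
      show "combine (f t) = t"
      proof (rule tensor_linear_eqI[OF T.module_axioms _ _ _ _ _ _ _ t,
            where p = "\<lambda>t. combine (f t)" and q = "\<lambda>t. t"])
        fix e a assume ea: "e \<in> carrier E" "a \<in> carrier A"
        have "pt e a = pt (l1 e \<odot>\<^bsub>E\<^esub> u1 \<oplus>\<^bsub>E\<^esub> (l2 e \<odot>\<^bsub>E\<^esub> u2 \<oplus>\<^bsub>E\<^esub> l3 e \<odot>\<^bsub>E\<^esub> u3)) a"
          using expand[OF ea(1)] by simp
        also have "\<dots> = combine (?h e a)"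
          using ea by (simp add: combine_def pure_tensor_bilinear u_closed l_closed)
        finally have "combine (?h e a) = pt e a" by (rule sym)
        thus "combine (f (pt e a)) = pt e a"
          unfolding f(4)[OF ea] .
      qed (auto simp: f(2,3) f_closed combine_closed[where m = m] combine_add combine_smult)
    qed
  qed (use f_closed combine_closed in auto)
qed

end

text \<open>
  The scalar \<open>s\<close> is the factor by which a product changes when its arguments are swapped, in \<open>A\<close>
  as well as between the basis vectors: \<open>-1\<close> for anticommutative and \<open>1\<close> for commutative
  algebras. Moving \<open>s\<close> across the tensor sign turns \<open>u3 u2 \<otimes> x3 y2 = 1/2 s u1 \<otimes> x3 y2\<close> into \<open>1/2 u1 \<otimes> y2 x3\<close>, which is how the
  second summand of the product of the triple arises.
\<close>

lemma (in framed_pair) triple_iso_tensor: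
  assumes hs: "half K \<in> carrier K" "s \<in> carrier K"
    and squares: "u1 \<otimes>\<^bsub>E\<^esub> u1 = \<zero>\<^bsub>E\<^esub>" "u2 \<otimes>\<^bsub>E\<^esub> u2 = \<zero>\<^bsub>E\<^esub>" "u3 \<otimes>\<^bsub>E\<^esub> u3 = \<zero>\<^bsub>E\<^esub>"
    and cyclic: "u2 \<otimes>\<^bsub>E\<^esub> u3 = half K \<odot>\<^bsub>E\<^esub> u1" "u3 \<otimes>\<^bsub>E\<^esub> u1 = half K \<odot>\<^bsub>E\<^esub> u2"
      "u1 \<otimes>\<^bsub>E\<^esub> u2 = half K \<odot>\<^bsub>E\<^esub> u3"
    and anticyclic: "u3 \<otimes>\<^bsub>E\<^esub> u2 = (half K \<otimes>\<^bsub>K\<^esub> s) \<odot>\<^bsub>E\<^esub> u1"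
      "u1 \<otimes>\<^bsub>E\<^esub> u3 = (half K \<otimes>\<^bsub>K\<^esub> s) \<odot>\<^bsub>E\<^esub> u2" "u2 \<otimes>\<^bsub>E\<^esub> u1 = (half K \<otimes>\<^bsub>K\<^esub> s) \<odot>\<^bsub>E\<^esub> u3"
    and flip: "\<And>x y. \<lbrakk>x \<in> carrier A; y \<in> carrier A\<rbrakk> \<Longrightarrow> y \<otimes>\<^bsub>A\<^esub> x = s \<odot>\<^bsub>A\<^esub> (x \<otimes>\<^bsub>A\<^esub> y)"
  shows "algebras_isomorphic K (triple K A) T"
proof -
  have zero: "pt \<zero>\<^bsub>E\<^esub> a = \<zero>\<^bsub>T\<^esub>" if "a \<in> carrier A" for a
    using pure_tensor_bilinear(3)[OF A.M.zero_closed that A.R.zero_closed]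
      pure_tensor_closed[OF A.M.zero_closed that] by simp
  have anti: "pt ((half K \<otimes>\<^bsub>K\<^esub> s) \<odot>\<^bsub>E\<^esub> e) (x \<otimes>\<^bsub>A\<^esub> y) = half K \<odot>\<^bsub>T\<^esub> pt e (y \<otimes>\<^bsub>A\<^esub> x)"
    if "e \<in> carrier E" "x \<in> carrier A" "y \<in> carrier A" for e x y
    using that hs
    by (simp add: pure_tensor_bilinear(3,4) pure_tensor_closed B.mult_closed T.smult_assoc1
        flip[of x y])
  have mult: "combine (x \<otimes>\<^bsub>triple K A\<^esub> y) = combine x \<otimes>\<^bsub>T\<^esub> combine y"
    if x: "x \<in> carrier (triple K A)" and y: "y \<in> carrier (triple K A)" for x y
  proof -
    obtain x1 x2 x3 y1 y2 y3 where xy: "x = (x1, x2, x3)" "y = (y1, y2, y3)"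
      and cl: "x1 \<in> carrier A" "x2 \<in> carrier A" "x3 \<in> carrier A"
        "y1 \<in> carrier A" "y2 \<in> carrier A" "y3 \<in> carrier A"
      using x y by (auto simp: triple_def cube_def)
    note pc = u_pure_tensor B.mult_closed T.mult_closed
    have "combine x \<otimes>\<^bsub>T\<^esub> combine y =
      half K \<odot>\<^bsub>T\<^esub> (pt u1 (x2 \<otimes>\<^bsub>A\<^esub> y3) \<oplus>\<^bsub>T\<^esub> pt u1 (y2 \<otimes>\<^bsub>A\<^esub> x3)) \<oplus>\<^bsub>T\<^esub>
      (half K \<odot>\<^bsub>T\<^esub> (pt u2 (x3 \<otimes>\<^bsub>A\<^esub> y1) \<oplus>\<^bsub>T\<^esub> pt u2 (y3 \<otimes>\<^bsub>A\<^esub> x1)) \<oplus>\<^bsub>T\<^esub>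
       half K \<odot>\<^bsub>T\<^esub> (pt u3 (x1 \<otimes>\<^bsub>A\<^esub> y2) \<oplus>\<^bsub>T\<^esub> pt u3 (y1 \<otimes>\<^bsub>A\<^esub> x2)))"
      using cl hs
      by (simp add: xy combine_def pc T.mult_add_left T.mult_add_right pure_tensor_mult u_closed
          squares cyclic anticyclic zero anti pure_tensor_bilinear(3)[OF _ _ hs(1)] T.smult_r_distr T.M.a_ac)
    also have "\<dots> = combine (x \<otimes>\<^bsub>triple K A\<^esub> y)"
      using cl hs
      by (simp add: xy triple_def cube_def combine_def pure_tensor_bilinear u_closed B.mult_closed)
    finally show ?thesis by simp
  qed
  have "combine \<in> algebra_iso K (triple K A) T"
    using combine_bij combine_add combine_smult mult
    unfolding algebra_iso_def triple_def by blast
  thus ?thesis by (auto simp: algebras_isomorphic_def)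
qed

section \<open>The special orthogonal and the simplicial algebra\<close>

lemma (in field) half_double:
  assumes "char_zero R" "x \<in> carrier R"
  shows "half R \<otimes> (x \<oplus> x) = x" and "(x \<oplus> x) \<otimes> half R = x"
proof -
  note h = half_props[OF assms(1)]
  have "half R \<otimes> (x \<oplus> x) = (half R \<oplus> half R) \<otimes> x"
    using h(1) assms(2) by (simp add: l_distr r_distr)
  thus "half R \<otimes> (x \<oplus> x) = x"
    using h assms(2) by simp
  thus "(x \<oplus> x) \<otimes> half R = x"
    using h(1) assms(2) by (simp add: m_comm)
qed

lemma triple_iso_so3:
  fixes K :: "('k, 'm) ring_scheme" and \<gg> :: "('k, 'a) module"
  assumes "field K" and char: "char_zero K" and \<gg>: "nonassoc_algebra K \<gg>"
    and anti: "anticommutative_mult \<gg>"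
  shows "algebras_isomorphic K (triple K \<gg>) (tensor K (so3 K) \<gg>)"
proof -
  interpret field K by fact
  interpret \<gg>: nonassoc_algebra K \<gg> by fact
  interpret S: nonassoc_algebra K "so3 K" by (rule so3_algebra)
  note h = half_props[OF char]
  let ?h = "half K" and ?z = "\<zero>\<^bsub>K\<^esub>"
  let ?dbl = "\<lambda>x. x \<oplus>\<^bsub>K\<^esub> x"
  note defs = so3_def cube_def self_module_def
  \<comment> \<open>The factor \<open>1/2\<close> is forced: \<open>(c e2) (c e3) = c (c e1)\<close> has to be \<open>1/2 (c e1)\<close>. The dual basis
    of the halved vectors doubles the coordinates.\<close>
  interpret framed_pair K "so3 K" \<gg> "(?h, ?z, ?z)" "(?z, ?h, ?z)" "(?z, ?z, ?h)"
    "\<lambda>(x, y, z). ?dbl x" "\<lambda>(x, y, z). ?dbl y" "\<lambda>(x, y, z). ?dbl z"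
    by unfold_locales (auto simp: defs h half_double[OF char] r_distr a_ac)
  show ?thesis
  proof (rule triple_iso_tensor[where s = "\<ominus>\<^bsub>K\<^esub> \<one>\<^bsub>K\<^esub>"])
    show "y \<otimes>\<^bsub>\<gg>\<^esub> x = (\<ominus>\<^bsub>K\<^esub> \<one>\<^bsub>K\<^esub>) \<odot>\<^bsub>\<gg>\<^esub> (x \<otimes>\<^bsub>\<gg>\<^esub> y)"
      if "x \<in> carrier \<gg>" "y \<in> carrier \<gg>" for x y
    proof -
      have "y \<otimes>\<^bsub>\<gg>\<^esub> x = \<ominus>\<^bsub>\<gg>\<^esub> (x \<otimes>\<^bsub>\<gg>\<^esub> y)"
        using that anti unfolding anticommutative_mult_def by blast
      thus ?thesis using that by (simp add: \<gg>.smult_l_minus \<gg>.mult_closed)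
    qed
  qed (auto simp: defs h minus_eq r_minus l_minus)
qed

text \<open>
  With \<open>ui = -1/2 (\<gamma>j + \<gamma>k)\<close> and \<open>\<gamma>i = ui - uj - uk\<close>, this is the coefficient of \<open>\<gamma>1\<close> when
  \<open>x \<gamma>1 + y \<gamma>2 + z \<gamma>3\<close> is written in the basis \<open>u1, u2, u3\<close> and expanded again; the other two
  coefficients are permuted instances.
\<close>

lemma (in field) simplicial_coordinate_recovery:
  assumes char: "char_zero R" and x: "x \<in> carrier R" "y \<in> carrier R" "z \<in> carrier R"
  shows "(y \<ominus> (x \<oplus> z)) \<otimes> (\<ominus> half R) \<oplus> (z \<ominus> (x \<oplus> y)) \<otimes> (\<ominus> half R) = x"
proof -
  have "(y \<ominus> (x \<oplus> z)) \<oplus> (z \<ominus> (x \<oplus> y)) = \<ominus> (x \<oplus> x)"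
    using x by algebra
  hence "(y \<ominus> (x \<oplus> z)) \<otimes> (\<ominus> half R) \<oplus> (z \<ominus> (x \<oplus> y)) \<otimes> (\<ominus> half R) =
      (\<ominus> (x \<oplus> x)) \<otimes> (\<ominus> half R)"
    using x half_props(1)[OF char] by (simp flip: l_distr)
  thus ?thesis
    using x half_props(1)[OF char] half_double[OF char, of x]
    by (simp add: l_minus r_minus)
qed

lemma triple_iso_simplicial3:
  fixes K :: "('k, 'm) ring_scheme" and A :: "('k, 'a) module"
  assumes "field K" and char: "char_zero K" and A: "nonassoc_algebra K A"
    and comm: "commutative_mult A"
  shows "algebras_isomorphic K (triple K A) (tensor K (simplicial3 K) A)"
proof -
  interpret field K by fact
  interpret A: nonassoc_algebra K A by fact
  interpret S: nonassoc_algebra K "simplicial3 K" by (rule simplicial_algebra[OF char])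
  note h = half_props[OF char]
  let ?n = "\<ominus>\<^bsub>K\<^esub> half K" and ?z = "\<zero>\<^bsub>K\<^esub>"
  note defs = simplicial3_def cube_def self_module_def
  interpret framed_pair K "simplicial3 K" A "(?z, ?n, ?n)" "(?n, ?z, ?n)" "(?n, ?n, ?z)"
    "\<lambda>(x, y, z). x \<ominus>\<^bsub>K\<^esub> (y \<oplus>\<^bsub>K\<^esub> z)" "\<lambda>(x, y, z). y \<ominus>\<^bsub>K\<^esub> (x \<oplus>\<^bsub>K\<^esub> z)" "\<lambda>(x, y, z). z \<ominus>\<^bsub>K\<^esub> (x \<oplus>\<^bsub>K\<^esub> y)"
  proof (unfold_locales, goal_cases)
    \<comment> \<open>The expansion of a vector in the basis; the normalisation below closes the other goals.\<close>
    case (22 v)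
    obtain a b c where v: "v = (a, b, c)" "a \<in> carrier K" "b \<in> carrier K" "c \<in> carrier K"
      using 22 by (auto simp: defs)
    show ?case
      using v(2-4) h(1) simplicial_coordinate_recovery[OF char, of a b c]
        simplicial_coordinate_recovery[OF char, of b a c]
        simplicial_coordinate_recovery[OF char, of c a b]
        a_comm[of b a] a_comm[of c a] a_comm[of c b] by (simp add: v(1) defs)
  qed (auto simp: defs h minus_eq minus_add a_ac l_distr r_distr l_minus r_minus m_comm r_neg)
  show ?thesis
  proof (rule triple_iso_tensor[where s = "\<one>\<^bsub>K\<^esub>"])
    show "y \<otimes>\<^bsub>A\<^esub> x = \<one>\<^bsub>K\<^esub> \<odot>\<^bsub>A\<^esub> (x \<otimes>\<^bsub>A\<^esub> y)"
      if "x \<in> carrier A" "y \<in> carrier A" for x y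
      using that comm by (simp add: commutative_mult_def A.mult_closed)
  qed (auto simp: defs h(1) minus_eq l_minus r_minus half_double[OF char] r_neg)
qed

theorem lemma11p3:
  fixes K :: "('k, 'm) ring_scheme"
  assumes "field K" and "char_zero K"
  shows
    "(\<forall>g :: ('k, 'a) module. fd_algebra K g \<and> anticommutative_mult g \<longrightarrow>
        algebras_isomorphic K (triple K g) (tensor K (so3 K) g)) \<and>
     (\<forall>A :: ('k, 'b) module. fd_algebra K A \<and> commutative_mult A \<longrightarrow>
        algebras_isomorphic K (triple K A) (tensor K (simplicial3 K) A))"
  using triple_iso_so3[OF assms] triple_iso_simplicial3[OF assms]
  by (auto simp: fd_algebra_def)

end
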